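(* In dimension $n=3$, the first Dirichlet eigenvalue of the Laplacian $\lambda_1$ (which is $(-2)$-homogeneous) does not satisfy the Kneser-Süss inequality; that is, it is not true that $$\lambda_1^{-1}(K\stackrel{.}{+}L)\ \ge\ \lambda_1^{-1}(K)+\lambda_1^{-1}(L)\qquad\forall\,K,L\in\mathcal{K}_0^3 .$$
   Context: $\mathcal{K}_0^3$ is the class of compact convex sets in $\mathbb{R}^3$ with nonempty interior; $\lambda_1(K)$ is the first eigenvalue of $-\Delta$ with homogeneous Dirichlet boundary conditions in the interior of $K$. An $\alpha$-homogeneous functional $F$ on convex bodies of $\mathbb{R}^n$ is said to satisfy the Kneser-Süss inequality if $F^{(n-1)/\alpha}(K\stackrel{.}{+}L)\ge F^{(n-1)/\alpha}(K)+F^{(n-1)/\alpha}(L)$ for all $K,L\in\mathcal{K}_0^n$; here $n=3$, $\alpha=-2$. Blaschke addition: for $K\in\mathcal{K}_0^n$ with Gauss map $\nu_K:\partial K\to\mathbb{S}^{n-1}$ (defined $\mathcal{H}^{n-1}$-a.e.), the surface area measure is $\mu(K)[\omega]=\mathcal{H}^{n-1}(\nu_K^{-1}(\omega))$ for Borel $\omega\subseteq\mathbb{S}^{n-1}$; $K\stackrel{.}{+}L\in\mathcal{K}_0^n$ is the convex body, unique up to translation, such that $\mu(K\stackrel{.}{+}L)=\mu(K)+\mu(L)$. *)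

theory Defs
  imports "HOL-Analysis.Analysis"
begin

definition convex_body :: "'a::euclidean_space set \<Rightarrow> bool" where
  "convex_body K \<longleftrightarrow> compact K \<and> convex K \<and> interior K \<noteq> {}"

text \<open>
  The \<open>m\<close>-dimensional Hausdorff (outer) measure, normalised so that it agrees with Lebesgue
  measure on \<open>\<real>\<^sup>m\<close>. Covering sets are required to be bounded because \<open>diameter\<close> is
  meaningful only for bounded sets. Empty covering sets are given weight \<open>0\<close> explicitly, since
  \<open>0 ^ 0 = 1\<close>.
\<close>

definition hausdorff_weight :: "nat \<Rightarrow> 'a::metric_space set \<Rightarrow> ennreal" where
  "hausdorff_weight m E =
     (if E = {} then 0 else ennreal (unit_ball_vol (real m) * (diameter E / 2) ^ m))"

definition hausdorff_premeasure :: "nat \<Rightarrow> real \<Rightarrow> 'a::metric_space set \<Rightarrow> ennreal" where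
  "hausdorff_premeasure m \<delta> A =
     (INF E \<in> {E :: nat \<Rightarrow> 'a set. A \<subseteq> (\<Union>i. E i) \<and> (\<forall>i. bounded (E i) \<and> diameter (E i) \<le> \<delta>)}.
        (\<Sum>i. hausdorff_weight m (E i)))"

definition hausdorff_measure :: "nat \<Rightarrow> 'a::metric_space set \<Rightarrow> ennreal" where
  "hausdorff_measure m A = (SUP \<delta> \<in> {0<..}. hausdorff_premeasure m \<delta> A)"

definition outer_unit_normal :: "'a::euclidean_space set \<Rightarrow> 'a \<Rightarrow> 'a \<Rightarrow> bool" where
  "outer_unit_normal K x v \<longleftrightarrow> norm v = 1 \<and> (\<forall>y\<in>K. v \<bullet> (y - x) \<le> 0)"

text \<open>
  The Gauss map is defined at those boundary points that have exactly one outer unit normal; the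
  other boundary points form a null set.
\<close>

definition gauss_domain :: "'a::euclidean_space set \<Rightarrow> 'a set" where
  "gauss_domain K = {x \<in> frontier K. \<exists>!v. outer_unit_normal K x v}"

definition gauss_map :: "'a::euclidean_space set \<Rightarrow> 'a \<Rightarrow> 'a" where
  "gauss_map K x = (THE v. outer_unit_normal K x v)"

definition surface_area_measure :: "'a::euclidean_space set \<Rightarrow> 'a set \<Rightarrow> ennreal" where
  "surface_area_measure K \<omega> =
     hausdorff_measure (DIM('a) - 1) (gauss_map K -` \<omega> \<inter> gauss_domain K)"

text \<open>
  The Blaschke sum of two convex bodies is determined only up to translation, so it is represented
  as a relation: \<open>blaschke_sum K L M\<close> says that \<open>M\<close> is a representative of the sum of
  \<open>K\<close> and \<open>L\<close>.
\<close>

definition blaschke_sum ::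
    "'a::euclidean_space set \<Rightarrow> 'a set \<Rightarrow> 'a set \<Rightarrow> bool" where
  "blaschke_sum K L M \<longleftrightarrow> convex_body M \<and>
     (\<forall>\<omega>. \<omega> \<in> sets borel \<and> \<omega> \<subseteq> sphere 0 1 \<longrightarrow>
        surface_area_measure M \<omega> = surface_area_measure K \<omega> + surface_area_measure L \<omega>)"

definition homogeneous_functional :: "real \<Rightarrow> ('a::euclidean_space set \<Rightarrow> real) \<Rightarrow> bool" where
  "homogeneous_functional \<alpha> F \<longleftrightarrow>
     (\<forall>K t. convex_body K \<and> t > 0 \<longrightarrow> F ((\<lambda>x. t *\<^sub>R x) ` K) = t powr \<alpha> * F K)"

definition kneser_suss :: "real \<Rightarrow> ('a::euclidean_space set \<Rightarrow> real) \<Rightarrow> bool" where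
  "kneser_suss \<alpha> F \<longleftrightarrow>
     (\<forall>K L M. convex_body K \<and> convex_body L \<and> blaschke_sum K L M \<longrightarrow>
        F M powr ((real DIM('a) - 1) / \<alpha>)
          \<ge> F K powr ((real DIM('a) - 1) / \<alpha>) + F L powr ((real DIM('a) - 1) / \<alpha>))"

definition partial :: "'a::euclidean_space \<Rightarrow> ('a \<Rightarrow> real) \<Rightarrow> 'a \<Rightarrow> real" where
  "partial i u x = frechet_derivative u (at x) i"

text \<open>
  For an open set \<open>S\<close> this is \<open>u \<in> C\<^sup>2(S)\<close>: the first partial derivatives are
  differentiable, hence continuous.
\<close>

definition C2_on :: "'a::euclidean_space set \<Rightarrow> ('a \<Rightarrow> real) \<Rightarrow> bool" where
  "C2_on S u \<longleftrightarrow> u differentiable_on S \<and>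
     (\<forall>i\<in>Basis. partial i u differentiable_on S \<and>
        (\<forall>j\<in>Basis. continuous_on S (partial j (partial i u))))"

definition laplacian :: "('a::euclidean_space \<Rightarrow> real) \<Rightarrow> 'a \<Rightarrow> real" where
  "laplacian u x = (\<Sum>i\<in>Basis. partial i (partial i u) x)"

text \<open>
  The eigenvalue problem is posed classically. For a convex body this is the same spectrum as that
  of the weak problem: weak eigenfunctions are smooth in the interior and, since every boundary
  point of a convex domain is regular, continuous up to the boundary with value \<open>0\<close>.
\<close>

definition dirichlet_eigenvalue :: "'a::euclidean_space set \<Rightarrow> real \<Rightarrow> bool" where
  "dirichlet_eigenvalue K l \<longleftrightarrow>
     (\<exists>u. continuous_on K u \<and> C2_on (interior K) u \<and>
          (\<exists>x\<in>interior K. u x \<noteq> 0) \<and>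
          (\<forall>x\<in>interior K. - laplacian u x = l * u x) \<and>
          (\<forall>x\<in>frontier K. u x = 0))"

text \<open>
  Every convex body has a smallest Dirichlet eigenvalue; the value \<open>0\<close> only makes the function
  total.
\<close>

definition lambda1 :: "'a::euclidean_space set \<Rightarrow> real" where
  "lambda1 K =
     (if \<exists>l. dirichlet_eigenvalue K l \<and> (\<forall>m. dirichlet_eigenvalue K m \<longrightarrow> l \<le> m)
      then LEAST l. dirichlet_eigenvalue K l else 0)"

end

theory Submission
  imports Defs
begin

text \<open>
  The counterexample consists of boxes. The first Dirichlet eigenvalue of a box with sides \<open>a, b, c\<close> is
  \<open>pi\<^sup>2 * (1 / a\<^sup>2 + 1 / b\<^sup>2 + 1 / c\<^sup>2)\<close>. In terms of the facet areas
  \<open>p = b * c\<close>, \<open>q = a * c\<close>, \<open>r = a * b\<close> its inverse is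
  \<open>p * q * r / (p\<^sup>2 + q\<^sup>2 + r\<^sup>2)\<close> divided by \<open>pi\<^sup>2\<close>. Blaschke addition of parallel boxes adds the
  triples \<open>(p, q, r)\<close>. The function above is homogeneous of degree 1, so it would have to be concave
  for the Kneser-Suess inequality to hold for boxes; but with \<open>q = r\<close> fixed it is convex in \<open>p\<close> as soon
  as \<open>p\<^sup>2 > 6 * q\<^sup>2\<close>. Flat bricks lie in this range. Those with sides \<open>1, 9, 9\<close> and
  \<open>3, 12, 12\<close> have the brick with sides \<open>3, 15, 15\<close> as a Blaschke sum, and up to the factor
  \<open>pi\<^sup>2\<close> the inverse eigenvalues are \<open>81 / 83\<close>, \<open>8\<close> and \<open>25 / 3\<close>. The inequality fails because
  \<open>81 / 83 + 8 > 25 / 3\<close>.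

  Two facts carry the proof. The surface area measure of a box with integer sides is computed in
  \<open>surface_area_measure_nat_box\<close>, up to the Hausdorff measure of a unit square, by counting unit cells.
  The eigenvalue of a box is found in \<open>lambda1_box\<close>: a product of sines is an eigenfunction, and
  comparison with the positive eigenfunctions of slightly larger boxes shows that no eigenvalue is
  smaller. Homogeneity of \<open>lambda1\<close> holds because \<open>x \<mapsto> u (x / t)\<close> turns eigenfunctions of a body
  \<open>K\<close> into eigenfunctions of \<open>t * K\<close>.
\<close>

section \<open>Hausdorff measure: scaling and additivity\<close>

lemma hausdorff_weight_mono:
  assumes "A \<subseteq> B" "bounded B"
  shows "hausdorff_weight m A \<le> hausdorff_weight m B"
proof (cases "A = {}")
  case False
  have "diameter A \<le> diameter B" "0 \<le> diameter A"
    using assms diameter_subset diameter_ge_0 bounded_subset by metis+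
  then show ?thesis
    using False assms
    by (auto simp: hausdorff_weight_def intro!: ennreal_leI mult_left_mono power_mono)
qed (simp add: hausdorff_weight_def)

lemma hausdorff_weight_empty [simp]: "hausdorff_weight m {} = 0"
  by (simp add: hausdorff_weight_def)

lemma hausdorff_premeasure_le:
  assumes "A \<subseteq> (\<Union>i. E i)" "\<And>i. bounded (E i)" "\<And>i. diameter (E i) \<le> \<delta>"
  shows "hausdorff_premeasure m \<delta> A \<le> (\<Sum>i. hausdorff_weight m (E i))"
  unfolding hausdorff_premeasure_def using assms by (intro INF_lower) auto

lemma hausdorff_premeasure_antimono:
  "\<delta> \<le> \<delta>' \<Longrightarrow> hausdorff_premeasure m \<delta>' A \<le> hausdorff_premeasure m \<delta> A"
  unfolding hausdorff_premeasure_def by (rule INF_superset_mono) (auto intro: order_trans)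

lemma hausdorff_premeasure_le_measure:
  "0 < \<delta> \<Longrightarrow> hausdorff_premeasure m \<delta> A \<le> hausdorff_measure m A"
  unfolding hausdorff_measure_def by (intro SUP_upper) simp

lemma hausdorff_measure_mono:
  assumes "A \<subseteq> B"
  shows "hausdorff_measure m A \<le> hausdorff_measure m B"
  unfolding hausdorff_measure_def hausdorff_premeasure_def
  using assms by (intro SUP_mono' INF_superset_mono) auto

lemma hausdorff_measure_empty [simp]: "hausdorff_measure m ({} :: 'a::metric_space set) = 0"
proof -
  have "hausdorff_premeasure m \<delta> ({} :: 'a set) = 0" if "0 < \<delta>" for \<delta>
    using hausdorff_premeasure_le[of "{} :: 'a set" "\<lambda>_. {}" \<delta> m] that by simp
  then show ?thesis
    by (simp add: hausdorff_measure_def cong: SUP_cong_simp)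
qed

text \<open>
  Images of a cover under a Lipschitz map form a cover whose diameters have grown by at most the
  Lipschitz constant. Applied to a similarity and to its inverse, this gives the exact scaling law.
\<close>

lemma hausdorff_measure_lipschitz_image_le:
  fixes f :: "'a::metric_space \<Rightarrow> 'b::metric_space"
  assumes "0 < L" and lip: "\<And>x y. x \<in> A \<Longrightarrow> y \<in> A \<Longrightarrow> dist (f x) (f y) \<le> L * dist x y"
  shows "hausdorff_measure m (f ` A) \<le> ennreal (L ^ m) * hausdorff_measure m A"
proof -
  have weight: "bounded (f ` (E \<inter> A)) \<and> diameter (f ` (E \<inter> A)) \<le> L * diameter E \<and>
      hausdorff_weight m (f ` (E \<inter> A)) \<le> ennreal (L ^ m) * hausdorff_weight m E"
    if E: "bounded E" for E
  proof (cases "E \<inter> A = {}")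
    case True
    then show ?thesis
      using diameter_ge_0[OF E] \<open>0 < L\<close> by simp
  next
    case False
    have d: "dist (f x) (f y) \<le> L * diameter E" if "x \<in> E \<inter> A" "y \<in> E \<inter> A" for x y
      using lip[of x y] diameter_bounded_bound[OF E, of x y] that \<open>0 < L\<close>
      by (smt (verit) IntE mult_left_mono)
    then have b: "bounded (f ` (E \<inter> A))"
      unfolding bounded_two_points by blast
    have dm: "diameter (f ` (E \<inter> A)) \<le> L * diameter E"
      using False d unfolding diameter_def[of "f ` _"] by (auto intro!: cSUP_least)
    have "unit_ball_vol (real m) * (diameter (f ` (E \<inter> A)) / 2) ^ m
        \<le> unit_ball_vol (real m) * (L * diameter E / 2) ^ m"
      using dm diameter_ge_0[OF b] by (intro mult_left_mono power_mono) auto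
    also have "\<dots> = L ^ m * (unit_ball_vol (real m) * (diameter E / 2) ^ m)"
      by (simp add: power_mult_distrib power_divide)
    finally show ?thesis
      using False b dm \<open>0 < L\<close>
      by (auto simp: hausdorff_weight_def ennreal_mult'[symmetric] intro!: ennreal_leI)
  qed
  have inv: "ennreal (L ^ m) * (ennreal (1 / L ^ m) * z) = z"
      "ennreal (1 / L ^ m) * (ennreal (L ^ m) * z) = z" for z
    using \<open>0 < L\<close> by (simp_all add: mult.assoc[symmetric] ennreal_mult'[symmetric])
  have pre: "hausdorff_premeasure m (L * \<delta>) (f ` A) \<le> ennreal (L ^ m) * hausdorff_premeasure m \<delta> A"
    for \<delta>
  proof -
    have "ennreal (1 / L ^ m) * hausdorff_premeasure m (L * \<delta>) (f ` A) \<le> hausdorff_premeasure m \<delta> A"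
      unfolding hausdorff_premeasure_def[of m \<delta> A]
    proof (rule INF_greatest)
      fix E :: "nat \<Rightarrow> 'a set"
      assume "E \<in> {E. A \<subseteq> (\<Union>i. E i) \<and> (\<forall>i. bounded (E i) \<and> diameter (E i) \<le> \<delta>)}"
      then have E: "A \<subseteq> (\<Union>i. E i)" "\<And>i. bounded (E i)" "\<And>i. diameter (E i) \<le> \<delta>"
        by auto
      have "hausdorff_premeasure m (L * \<delta>) (f ` A) \<le> (\<Sum>i. hausdorff_weight m (f ` (E i \<inter> A)))"
      proof (rule hausdorff_premeasure_le)
        show "diameter (f ` (E i \<inter> A)) \<le> L * \<delta>" for i
          using weight[OF E(2)[of i]] E(3)[of i] \<open>0 < L\<close> by (smt (verit) mult_left_mono)
        show "f ` A \<subseteq> (\<Union>i. f ` (E i \<inter> A))"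
          using E(1) by blast
      qed (use E weight in auto)
      also have "\<dots> \<le> (\<Sum>i. ennreal (L ^ m) * hausdorff_weight m (E i))"
        using weight E(2) by (intro suminf_le) auto
      finally have "hausdorff_premeasure m (L * \<delta>) (f ` A)
          \<le> ennreal (L ^ m) * (\<Sum>i. hausdorff_weight m (E i))"
        by simp
      then show "ennreal (1 / L ^ m) * hausdorff_premeasure m (L * \<delta>) (f ` A)
          \<le> (\<Sum>i. hausdorff_weight m (E i))"
        using inv(2) mult_left_mono by (metis zero_le)
    qed
    then show ?thesis
      using inv(1) mult_left_mono by (metis zero_le)
  qed
  show ?thesis
    unfolding hausdorff_measure_def[of m "f ` A"]
  proof (rule SUP_least)
    fix \<delta> :: real
    assume "\<delta> \<in> {0<..}"
    then have \<delta>: "0 < \<delta> / L" "L * (\<delta> / L) = \<delta>"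
      using \<open>0 < L\<close> by auto
    show "hausdorff_premeasure m \<delta> (f ` A) \<le> ennreal (L ^ m) * hausdorff_measure m A"
      using pre[of "\<delta> / L"] hausdorff_premeasure_le_measure[OF \<delta>(1), of m A] \<delta>(2)
      by (metis mult_left_mono order_trans zero_le)
  qed
qed

lemma hausdorff_measure_similarity:
  fixes A :: "'a::real_normed_vector set"
  assumes "0 < s"
  shows "hausdorff_measure m ((\<lambda>x. a + s *\<^sub>R x) ` A) = ennreal (s ^ m) * hausdorff_measure m A"
proof (rule antisym)
  have d: "dist (a + t *\<^sub>R x) (a + t *\<^sub>R y) = t * dist x y" if "0 < t" for t and a x y :: 'a
    using that by (simp add: dist_norm flip: scaleR_diff_right)
  show "hausdorff_measure m ((\<lambda>x. a + s *\<^sub>R x) ` A) \<le> ennreal (s ^ m) * hausdorff_measure m A"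
    using assms d[OF assms] by (intro hausdorff_measure_lipschitz_image_le) auto
  define g where "g = (\<lambda>x. - (a /\<^sub>R s) + (1 / s) *\<^sub>R x)"
  have g: "g ` (\<lambda>x. a + s *\<^sub>R x) ` A = A"
    using assms by (auto simp: g_def image_image algebra_simps divide_inverse)
  have "hausdorff_measure m (g ` (\<lambda>x. a + s *\<^sub>R x) ` A)
      \<le> ennreal ((1 / s) ^ m) * hausdorff_measure m ((\<lambda>x. a + s *\<^sub>R x) ` A)"
  proof (rule hausdorff_measure_lipschitz_image_le)
    show "dist (g x) (g y) \<le> 1 / s * dist x y" for x y
      unfolding g_def using assms by (subst d) auto
  qed (use assms in auto)
  then have "ennreal (s ^ m) * hausdorff_measure m A
      \<le> ennreal (s ^ m) * (ennreal ((1 / s) ^ m) * hausdorff_measure m ((\<lambda>x. a + s *\<^sub>R x) ` A))"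
    unfolding g by (intro mult_left_mono) auto
  also have "\<dots> = hausdorff_measure m ((\<lambda>x. a + s *\<^sub>R x) ` A)"
    using assms
    by (simp add: mult.assoc[symmetric] ennreal_mult'[symmetric] power_mult_distrib[symmetric])
  finally show "ennreal (s ^ m) * hausdorff_measure m A
      \<le> hausdorff_measure m ((\<lambda>x. a + s *\<^sub>R x) ` A)" .
qed

lemma hausdorff_premeasure_Un_le:
  "hausdorff_premeasure m \<delta> (A \<union> B) \<le> hausdorff_premeasure m \<delta> A + hausdorff_premeasure m \<delta> B"
proof (rule ennreal_le_epsilon)
  fix e :: real
  assume fin: "hausdorff_premeasure m \<delta> A + hausdorff_premeasure m \<delta> B < top" and "0 < e"
  have "\<exists>E. X \<subseteq> (\<Union>i. E i) \<and> (\<forall>i. bounded (E i) \<and> diameter (E i) \<le> \<delta>) \<and>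
      (\<Sum>i. hausdorff_weight m (E i)) < hausdorff_premeasure m \<delta> X + ennreal (e / 2)"
    if "hausdorff_premeasure m \<delta> X < top" for X :: "'a set"
  proof -
    have "hausdorff_premeasure m \<delta> X < hausdorff_premeasure m \<delta> X + ennreal (e / 2)"
      using that \<open>0 < e\<close> by simp
    then show ?thesis
      by (subst (asm) hausdorff_premeasure_def) (auto simp: INF_less_iff)
  qed
  from this[of A] this[of B] fin obtain E F :: "nat \<Rightarrow> 'a set"
    where E: "A \<subseteq> (\<Union>i. E i)" "\<And>i. bounded (E i)" "\<And>i. diameter (E i) \<le> \<delta>"
        "(\<Sum>i. hausdorff_weight m (E i)) < hausdorff_premeasure m \<delta> A + ennreal (e / 2)"
      and F: "B \<subseteq> (\<Union>i. F i)" "\<And>i. bounded (F i)" "\<And>i. diameter (F i) \<le> \<delta>"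
        "(\<Sum>i. hausdorff_weight m (F i)) < hausdorff_premeasure m \<delta> B + ennreal (e / 2)"
    by (auto simp: ennreal_add_less_top)
  have "0 \<le> \<delta>"
    using diameter_ge_0[OF E(2)] E(3) order_trans by blast
  \<comment> \<open>The cover of the union is indexed by pairs: row 0 holds \<open>E\<close>, row 1 holds \<open>F\<close>.\<close>
  define G where "G = (\<lambda>(k, i). if k = (0::nat) then E i else if k = 1 then F i else {})"
  have "hausdorff_premeasure m \<delta> (A \<union> B) \<le> (\<Sum>i. hausdorff_weight m (G (prod_decode i)))"
  proof (rule hausdorff_premeasure_le)
    have "\<exists>i. x \<in> G (prod_decode i)" if x: "x \<in> A \<union> B" for x
    proof -
      have "\<exists>p. x \<in> G p"
      proof (cases "x \<in> A")
        case True
        then obtain i where "x \<in> G (0, i)" using E(1) by (auto simp: G_def)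
        then show ?thesis ..
      next
        case False
        then obtain i where "x \<in> G (1, i)" using F(1) x by (auto simp: G_def)
        then show ?thesis ..
      qed
      then show ?thesis by (metis prod_encode_inverse)
    qed
    then show "A \<union> B \<subseteq> (\<Union>i. G (prod_decode i))" by auto
  qed (use E F \<open>0 \<le> \<delta>\<close> in \<open>auto simp: G_def split: prod.split\<close>)
  also have "\<dots> = (\<Sum>k. \<Sum>i. hausdorff_weight m (G (k, i)))"
    using suminf_ennreal_2dimen[where f = "\<lambda>p. hausdorff_weight m (G p)"] by simp
  also have "\<dots> = (\<Sum>k\<in>{0, 1}. \<Sum>i. hausdorff_weight m (G (k, i)))"
    by (intro suminf_finite) (auto simp: G_def)
  also have "\<dots> = (\<Sum>i. hausdorff_weight m (E i)) + (\<Sum>i. hausdorff_weight m (F i))"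
    by (simp add: G_def)
  also have "\<dots> \<le> (hausdorff_premeasure m \<delta> A + ennreal (e / 2))
      + (hausdorff_premeasure m \<delta> B + ennreal (e / 2))"
    using E(4) F(4) by (intro add_mono) auto
  also have "\<dots> = hausdorff_premeasure m \<delta> A + hausdorff_premeasure m \<delta> B
      + (ennreal (e / 2) + ennreal (e / 2))"
    by (simp add: ac_simps)
  also have "ennreal (e / 2) + ennreal (e / 2) = ennreal e"
    using \<open>0 < e\<close> by (simp flip: ennreal_plus)
  finally show "hausdorff_premeasure m \<delta> (A \<union> B)
      \<le> hausdorff_premeasure m \<delta> A + hausdorff_premeasure m \<delta> B + ennreal e" .
qed

lemma hausdorff_measure_Un_le:
  "hausdorff_measure m (A \<union> B) \<le> hausdorff_measure m A + hausdorff_measure m B"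
  unfolding hausdorff_measure_def[of m "A \<union> B"]
proof (rule SUP_least)
  fix \<delta> :: real
  assume "\<delta> \<in> {0<..}"
  then show "hausdorff_premeasure m \<delta> (A \<union> B) \<le> hausdorff_measure m A + hausdorff_measure m B"
    using hausdorff_premeasure_Un_le[of m \<delta> A B]
      add_mono[OF hausdorff_premeasure_le_measure[of \<delta> m A] hausdorff_premeasure_le_measure[of \<delta> m B]]
    by (auto intro: order_trans)
qed

lemma hausdorff_measure_UN_le:
  "finite I \<Longrightarrow> hausdorff_measure m (\<Union>i\<in>I. A i) \<le> (\<Sum>i\<in>I. hausdorff_measure m (A i))"
  by (induction I rule: finite_induct)
    (simp_all add: order_trans[OF hausdorff_measure_Un_le add_left_mono])

text \<open>
  A covering set of diameter less than the distance of \<open>A\<close> and \<open>B\<close> meets only one of them, so a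
  fine cover of the union splits into a cover of \<open>A\<close> and a cover of \<open>B\<close>.
\<close>

lemma hausdorff_measure_separated_Un:
  fixes A B :: "'a::metric_space set"
  assumes "0 < d" and sep: "\<And>x y. x \<in> A \<Longrightarrow> y \<in> B \<Longrightarrow> d \<le> dist x y"
  shows "hausdorff_measure m A + hausdorff_measure m B \<le> hausdorff_measure m (A \<union> B)"
proof -
  have pre: "hausdorff_premeasure m \<delta> A + hausdorff_premeasure m \<delta> B \<le> hausdorff_premeasure m \<delta> (A \<union> B)"
    if "\<delta> < d" for \<delta>
    unfolding hausdorff_premeasure_def[of m \<delta> "A \<union> B"]
  proof (rule INF_greatest)
    fix E :: "nat \<Rightarrow> 'a set"
    assume "E \<in> {E. A \<union> B \<subseteq> (\<Union>i. E i) \<and> (\<forall>i. bounded (E i) \<and> diameter (E i) \<le> \<delta>)}"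
    then have E: "A \<union> B \<subseteq> (\<Union>i. E i)" "\<And>i. bounded (E i)" "\<And>i. diameter (E i) \<le> \<delta>"
      by auto
    have part: "hausdorff_premeasure m \<delta> X \<le> (\<Sum>i. hausdorff_weight m (E i \<inter> X))"
      if "X \<subseteq> A \<union> B" for X
    proof (rule hausdorff_premeasure_le)
      show "diameter (E i \<inter> X) \<le> \<delta>" for i
        using E(3)[of i] diameter_subset[of "E i \<inter> X" "E i"] E(2)[of i] by auto
      show "bounded (E i \<inter> X)" for i
        using E(2) by auto
    qed (use E(1) that in auto)
    have split: "hausdorff_weight m (E i \<inter> A) + hausdorff_weight m (E i \<inter> B) \<le> hausdorff_weight m (E i)"
      for i
    proof -
      have "E i \<inter> A = {} \<or> E i \<inter> B = {}"
      proof (rule ccontr)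
        assume "\<not> ?thesis"
        then obtain x y where "x \<in> E i" "x \<in> A" "y \<in> E i" "y \<in> B"
          by blast
        then show False
          using sep[of x y] diameter_bounded_bound[OF E(2)[of i], of x y] E(3)[of i] \<open>\<delta> < d\<close>
          by linarith
      qed
      then show ?thesis
        using hausdorff_weight_mono[OF Int_lower1 E(2), where m = m] by auto
    qed
    have "hausdorff_premeasure m \<delta> A + hausdorff_premeasure m \<delta> B
        \<le> (\<Sum>i. hausdorff_weight m (E i \<inter> A)) + (\<Sum>i. hausdorff_weight m (E i \<inter> B))"
      using part by (intro add_mono) auto
    also have "\<dots> = (\<Sum>i. hausdorff_weight m (E i \<inter> A) + hausdorff_weight m (E i \<inter> B))"
      by (rule suminf_add) auto
    also have "\<dots> \<le> (\<Sum>i. hausdorff_weight m (E i))"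
      using split by (intro suminf_le) auto
    finally show "hausdorff_premeasure m \<delta> A + hausdorff_premeasure m \<delta> B
        \<le> (\<Sum>i. hausdorff_weight m (E i))" .
  qed
  have le: "hausdorff_premeasure m \<delta> A + hausdorff_premeasure m \<delta>' B \<le> hausdorff_measure m (A \<union> B)"
    if "0 < \<delta>" "0 < \<delta>'" for \<delta> \<delta>'
  proof -
    define \<eta> where "\<eta> = min (min \<delta> \<delta>') (d / 2)"
    have \<eta>: "0 < \<eta>" "\<eta> < d" "\<eta> \<le> \<delta>" "\<eta> \<le> \<delta>'"
      using that \<open>0 < d\<close> by (auto simp: \<eta>_def)
    have "hausdorff_premeasure m \<delta> A + hausdorff_premeasure m \<delta>' B
        \<le> hausdorff_premeasure m \<eta> A + hausdorff_premeasure m \<eta> B"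
      using \<eta> by (intro add_mono hausdorff_premeasure_antimono)
    also have "\<dots> \<le> hausdorff_measure m (A \<union> B)"
      using pre[OF \<eta>(2)] hausdorff_premeasure_le_measure[OF \<eta>(1)] order_trans by blast
    finally show ?thesis .
  qed
  have "hausdorff_measure m A + hausdorff_measure m B
      = (SUP \<delta>'\<in>{0<..}. SUP \<delta>\<in>{0<..}. hausdorff_premeasure m \<delta> A + hausdorff_premeasure m \<delta>' B)"
    by (simp add: hausdorff_measure_def ennreal_SUP_add_right ennreal_SUP_add_left)
  also have "\<dots> \<le> hausdorff_measure m (A \<union> B)"
    using le by (intro SUP_least) auto
  finally show ?thesis .
qed

lemma hausdorff_measure_separated_UN:
  fixes A :: "'i \<Rightarrow> 'a::metric_space set"
  assumes "finite I" "0 < d"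
    and "\<And>i j x y. i \<in> I \<Longrightarrow> j \<in> I \<Longrightarrow> i \<noteq> j \<Longrightarrow> x \<in> A i \<Longrightarrow> y \<in> A j \<Longrightarrow> d \<le> dist x y"
  shows "(\<Sum>i\<in>I. hausdorff_measure m (A i)) \<le> hausdorff_measure m (\<Union>i\<in>I. A i)"
  using assms(1,3)
proof (induction I rule: finite_induct)
  case (insert i I)
  have "hausdorff_measure m (A i) + hausdorff_measure m (\<Union>j\<in>I. A j)
      \<le> hausdorff_measure m (A i \<union> (\<Union>j\<in>I. A j))"
  proof (rule hausdorff_measure_separated_Un[OF \<open>0 < d\<close>])
    fix x y
    assume "x \<in> A i" "y \<in> (\<Union>j\<in>I. A j)"
    then obtain j where "j \<in> I" "y \<in> A j" by blast
    then show "d \<le> dist x y"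
      using insert.prems[of i j x y] insert.hyps \<open>x \<in> A i\<close> by auto
  qed
  moreover have "(\<Sum>j\<in>I. hausdorff_measure m (A j)) \<le> hausdorff_measure m (\<Union>j\<in>I. A j)"
    using insert.prems by (intro insert.IH) auto
  ultimately show ?case
    using insert.hyps by (simp add: order_trans[OF add_left_mono])
qed simp

section \<open>Surface area measure of boxes\<close>

definition nat_box :: "('a::euclidean_space \<Rightarrow> nat) \<Rightarrow> 'a set" where
  "nat_box n = cbox 0 (\<Sum>j\<in>Basis. real (n j) *\<^sub>R j)"

lemma sum_Basis_inner: "k \<in> Basis \<Longrightarrow> (\<Sum>j\<in>Basis. f j *\<^sub>R j) \<bullet> k = f k"
  by (simp add: inner_sum_left inner_Basis if_distrib cong: if_cong)

lemma mem_nat_box: "x \<in> nat_box n \<longleftrightarrow> (\<forall>j\<in>Basis. 0 \<le> x \<bullet> j \<and> x \<bullet> j \<le> real (n j))"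
  by (simp add: nat_box_def mem_box sum_Basis_inner)

lemma frontier_nat_box:
  "x \<in> frontier (nat_box n) \<longleftrightarrow> x \<in> nat_box n \<and> (\<exists>j\<in>Basis. x \<bullet> j = 0 \<or> x \<bullet> j = real (n j))"
  unfolding mem_nat_box unfolding nat_box_def frontier_cbox
  by (simp add: mem_box sum_Basis_inner) (metis order_less_le)

lemma convex_body_nat_box:
  assumes "\<forall>j\<in>Basis. 0 < n j"
  shows "convex_body (nat_box n)"
proof -
  have "(1 / 2) *\<^sub>R (\<Sum>j\<in>Basis. real (n j) *\<^sub>R j) \<in> interior (nat_box n)"
    using assms by (auto simp: nat_box_def mem_box sum_Basis_inner)
  then show ?thesis
    by (auto simp: convex_body_def nat_box_def)
qed

text \<open>
  A facet of a box is given by a pair \<open>(i, b)\<close>: it lies in a hyperplane orthogonal to the basis vector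
  \<open>i\<close>, the one through the far corner if \<open>b\<close> holds and the one through the origin otherwise.
\<close>

definition facet_normal :: "'a::euclidean_space \<times> bool \<Rightarrow> 'a" where
  "facet_normal p = (if snd p then fst p else - fst p)"

text \<open>
  For \<open>\<delta> = 0\<close> this is the closed unit cube of dimension one less than the space, orthogonal to \<open>i\<close>
  and with lower corner \<open>k\<close>; for \<open>\<delta> > 0\<close> it is that cube shrunk by \<open>\<delta>\<close> at every side.
\<close>

definition facet_cell :: "real \<Rightarrow> 'a::euclidean_space \<Rightarrow> ('a \<Rightarrow> nat) \<Rightarrow> 'a set" where
  "facet_cell \<delta> i k = {x. x \<bullet> i = real (k i) \<and>
     (\<forall>j\<in>Basis - {i}. real (k j) + \<delta> \<le> x \<bullet> j \<and> x \<bullet> j \<le> real (k j) + 1 - \<delta>)}"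

definition facet_corners :: "('a::euclidean_space \<Rightarrow> nat) \<Rightarrow> 'a \<times> bool \<Rightarrow> ('a \<Rightarrow> nat) set" where
  "facet_corners n p =
     (\<Pi>\<^sub>E j\<in>Basis. if j = fst p then {if snd p then n j else 0} else {..<n j})"

lemma finite_facet_corners: "finite (facet_corners n p)"
  unfolding facet_corners_def by (intro finite_PiE) auto

lemma card_facet_corners:
  assumes "fst p \<in> Basis"
  shows "card (facet_corners n p) = (\<Prod>j\<in>Basis - {fst p}. n j)"
proof -
  have "card (facet_corners n p)
      = (\<Prod>j\<in>Basis. card (if j = fst p then {if snd p then n j else 0} else {..<n j}))"
    unfolding facet_corners_def by (rule card_PiE) simp
  also have "\<dots> = (\<Prod>j\<in>Basis - {fst p}. n j)"
    using assms by (simp add: prod.remove[of Basis "fst p"])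
  finally show ?thesis .
qed

lemma facet_corners_D:
  assumes "k \<in> facet_corners n (i, b)" "i \<in> Basis"
  shows "k i = (if b then n i else 0)" "\<And>j. j \<in> Basis \<Longrightarrow> j \<noteq> i \<Longrightarrow> k j < n j"
proof -
  have *: "k j \<in> (if j = i then {if b then n j else 0} else {..<n j})" if "j \<in> Basis" for j
    using PiE_mem[OF assms(1)[unfolded facet_corners_def] that] by (simp only: fst_conv snd_conv)
  show "k i = (if b then n i else 0)"
    using *[OF assms(2)] by simp
  show "k j < n j" if "j \<in> Basis" "j \<noteq> i" for j
    using *[OF that(1)] that(2) by simp
qed

lemma hausdorff_measure_facet_cell:
  fixes i :: "'a::euclidean_space"
  assumes "i \<in> Basis" "\<delta> < 1 / 2"
  shows "hausdorff_measure m (facet_cell \<delta> i k)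
    = ennreal ((1 - 2 * \<delta>) ^ m) * hausdorff_measure m (facet_cell 0 i (\<lambda>_. 0))"
proof -
  define a where "a = (\<Sum>j\<in>Basis. (real (k j) + (if j = i then 0 else \<delta>)) *\<^sub>R j)"
  define s where "s = 1 - 2 * \<delta>"
  have "0 < s"
    using assms by (simp add: s_def)
  have a: "a \<bullet> j = real (k j) + (if j = i then 0 else \<delta>)" if "j \<in> Basis" for j
    using that unfolding a_def by (rule sum_Basis_inner)
  have "facet_cell \<delta> i k = (\<lambda>x. a + s *\<^sub>R x) ` facet_cell 0 i (\<lambda>_. 0)"
  proof (intro equalityI subsetI)
    fix x
    assume x: "x \<in> facet_cell \<delta> i k"
    have "0 \<le> (x \<bullet> j - a \<bullet> j) / s" "(x \<bullet> j - a \<bullet> j) / s \<le> 1" if "j \<in> Basis - {i}" for j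
    proof -
      have "real (k j) + \<delta> \<le> x \<bullet> j" "x \<bullet> j \<le> real (k j) + 1 - \<delta>"
        using x that by (auto simp: facet_cell_def)
      then have "0 \<le> x \<bullet> j - a \<bullet> j" "x \<bullet> j - a \<bullet> j \<le> s"
        using that by (auto simp: a s_def)
      then show "0 \<le> (x \<bullet> j - a \<bullet> j) / s" "(x \<bullet> j - a \<bullet> j) / s \<le> 1"
        using \<open>0 < s\<close> by simp_all
    qed
    then have "(1 / s) *\<^sub>R (x - a) \<in> facet_cell 0 i (\<lambda>_. 0)"
      using x assms(1) by (simp add: facet_cell_def a inner_diff_left)
    moreover have "x = a + s *\<^sub>R ((1 / s) *\<^sub>R (x - a))"
      using \<open>0 < s\<close> by simp
    ultimately show "x \<in> (\<lambda>x. a + s *\<^sub>R x) ` facet_cell 0 i (\<lambda>_. 0)"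
      by blast
  next
    fix y
    assume "y \<in> (\<lambda>x. a + s *\<^sub>R x) ` facet_cell 0 i (\<lambda>_. 0)"
    then obtain x where x: "x \<in> facet_cell 0 i (\<lambda>_. 0)" and y: "y = a + s *\<^sub>R x"
      by blast
    have "real (k j) + \<delta> \<le> y \<bullet> j \<and> y \<bullet> j \<le> real (k j) + 1 - \<delta>" if "j \<in> Basis - {i}" for j
    proof -
      have "0 \<le> s * (x \<bullet> j)" "s * (x \<bullet> j) \<le> s"
        using x that \<open>0 < s\<close> by (auto simp: facet_cell_def)
      moreover have "y \<bullet> j = real (k j) + \<delta> + s * (x \<bullet> j)"
        using that by (simp add: y a inner_add_left)
      ultimately show ?thesis
        by (simp add: s_def)
    qed
    moreover have "y \<bullet> i = real (k i)"
      using x assms(1) by (simp add: facet_cell_def y a inner_add_left)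
    ultimately show "y \<in> facet_cell \<delta> i k"
      by (simp add: facet_cell_def)
  qed
  then show ?thesis
    using hausdorff_measure_similarity[OF \<open>0 < s\<close>] by (simp add: s_def)
qed

text \<open>
  Two cells on parallel facets, or on the same facet, differ in some coordinate of their corners. If
  the facets are orthogonal to distinct \<open>i\<close> and \<open>i'\<close>, then the \<open>i\<close>-th coordinate is an integer
  throughout the first cell and stays away from all integers by \<open>\<delta>\<close> in the second one.
\<close>

lemma facet_cells_separated:
  assumes \<delta>: "0 < \<delta>" "\<delta> < 1 / 2" and n: "\<forall>j\<in>Basis. 0 < n j"
    and i: "i \<in> Basis" "i' \<in> Basis"
    and k: "k \<in> facet_corners n (i, b)" "k' \<in> facet_corners n (i', b')"
    and ne: "((i, b), k) \<noteq> ((i', b'), k')"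
    and x: "x \<in> facet_cell \<delta> i k" and y: "y \<in> facet_cell \<delta> i' k'"
  shows "\<delta> \<le> dist x y"
proof -
  have "\<exists>j\<in>Basis. \<delta> \<le> \<bar>x \<bullet> j - y \<bullet> j\<bar>"
  proof (cases "i = i'")
    case True
    have "\<exists>j\<in>Basis. k j \<noteq> k' j"
    proof (cases "b = b'")
      case False
      then show ?thesis
        using facet_corners_D(1)[OF k(1) i(1)] facet_corners_D(1)[OF k(2) i(2)] bspec[OF n i(1)] True i
        by (intro bexI[of _ i]) auto
    next
      case eq: True
      with ne True have "k \<noteq> k'" by simp
      then show ?thesis
        using PiE_ext[OF k(1)[unfolded facet_corners_def] k(2)[folded True eq, unfolded facet_corners_def]]
        by blast
    qed
    then obtain j where j: "j \<in> Basis" "k j \<noteq> k' j" by blast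
    then have gap: "real (k j) + 1 \<le> real (k' j) \<or> real (k' j) + 1 \<le> real (k j)"
      by linarith
    have "\<delta> \<le> \<bar>x \<bullet> j - y \<bullet> j\<bar>"
    proof (cases "j = i")
      case True
      then have "x \<bullet> j = real (k j)" "y \<bullet> j = real (k' j)"
        using x y \<open>i = i'\<close> by (auto simp: facet_cell_def)
      with gap show ?thesis
        using \<delta> by linarith
    next
      case False
      then have "real (k j) + \<delta> \<le> x \<bullet> j" "x \<bullet> j \<le> real (k j) + 1 - \<delta>"
          "real (k' j) + \<delta> \<le> y \<bullet> j" "y \<bullet> j \<le> real (k' j) + 1 - \<delta>"
        using x y j \<open>i = i'\<close> by (auto simp: facet_cell_def)
      with gap show ?thesis
        using \<delta> by linarith
    qed
    with j show ?thesis by blast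
  next
    case False
    have "real (k i) \<le> real (k' i) \<or> real (k' i) + 1 \<le> real (k i)"
      by (cases "k i \<le> k' i") auto
    moreover have "x \<bullet> i = real (k i)" "real (k' i) + \<delta> \<le> y \<bullet> i" "y \<bullet> i \<le> real (k' i) + 1 - \<delta>"
      using x y i False by (auto simp: facet_cell_def)
    ultimately have "\<delta> \<le> \<bar>x \<bullet> i - y \<bullet> i\<bar>"
      by linarith
    with i show ?thesis by blast
  qed
  then obtain j where "j \<in> Basis" "\<delta> \<le> \<bar>x \<bullet> j - y \<bullet> j\<bar>" by blast
  then show ?thesis
    using Basis_le_norm[of j "x - y"] by (simp add: dist_norm inner_diff_left)
qed

lemma outer_unit_normal_facet:
  assumes "i \<in> Basis" "x \<bullet> i = (if b then real (n i) else 0)"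
  shows "outer_unit_normal (nat_box n) x (facet_normal (i, b))"
  using assms by (auto simp: outer_unit_normal_def facet_normal_def mem_nat_box inner_diff_right inner_commute)

lemma gauss_map_eq:
  assumes "x \<in> gauss_domain K" "outer_unit_normal K x v"
  shows "gauss_map K x = v"
  using assms unfolding gauss_domain_def gauss_map_def by (auto intro: the1_equality)

text \<open>
  Where the Gauss map is defined, it equals the normal of any facet through the point, and every facet
  is tiled by closed unit cells.
\<close>

lemma gauss_preimage_subset_cells:
  fixes n :: "'a::euclidean_space \<Rightarrow> nat"
  assumes n: "\<forall>j\<in>Basis. 0 < n j"
    and x: "x \<in> gauss_domain (nat_box n)" "gauss_map (nat_box n) x \<in> \<omega>"
  shows "\<exists>i b. \<exists>k\<in>facet_corners n (i, b). i \<in> Basis \<and> facet_normal (i, b) \<in> \<omega> \<and> x \<in> facet_cell 0 i k"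
proof -
  have fr: "x \<in> frontier (nat_box n)"
    using x(1) by (simp add: gauss_domain_def)
  then have bounds: "0 \<le> x \<bullet> j" "x \<bullet> j \<le> real (n j)" if "j \<in> Basis" for j
    using that by (auto simp: frontier_nat_box mem_nat_box)
  obtain i b where i: "i \<in> Basis" "x \<bullet> i = (if b then real (n i) else 0)"
  proof -
    obtain j where "j \<in> Basis" "x \<bullet> j = 0 \<or> x \<bullet> j = real (n j)"
      using fr unfolding frontier_nat_box by blast
    then show thesis
      using that[of j "x \<bullet> j = real (n j)"] by auto
  qed
  have "facet_normal (i, b) \<in> \<omega>"
    using gauss_map_eq[OF x(1) outer_unit_normal_facet[OF i(1), of x b n]] i(2) x(2) by simp
  define k where "k = restrict (\<lambda>j. if j = i then if b then n j else 0
      else min (nat \<lfloor>x \<bullet> j\<rfloor>) (n j - 1)) Basis"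
  have "k \<in> facet_corners n (i, b)"
    using n by (auto simp: facet_corners_def k_def min_less_iff_disj)
  moreover have "x \<in> facet_cell 0 i k"
  proof -
    have "real (k j) \<le> x \<bullet> j \<and> x \<bullet> j \<le> real (k j) + 1" if j: "j \<in> Basis" "j \<noteq> i" for j
    proof -
      have kj: "k j = min (nat \<lfloor>x \<bullet> j\<rfloor>) (n j - 1)"
        using j by (simp add: k_def)
      have fl: "real (nat \<lfloor>x \<bullet> j\<rfloor>) \<le> x \<bullet> j" "x \<bullet> j \<le> real (nat \<lfloor>x \<bullet> j\<rfloor>) + 1"
        using bounds(1)[OF j(1)] by linarith+
      have "real (n j - 1) = real (n j) - 1"
        using bspec[OF n j(1)] by simp
      then show ?thesis
        using fl bounds(2)[OF j(1)] unfolding kj by linarith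
    qed
    then show ?thesis
      using i by (auto simp: facet_cell_def k_def)
  qed
  ultimately show ?thesis
    using i(1) \<open>facet_normal (i, b) \<in> \<omega>\<close> by blast
qed

text \<open>
  A point of a shrunk cell can be moved a little along \<open>j\<close> in both senses, for every basis vector
  \<open>j \<noteq> i\<close>, without leaving the box. So every outer normal is parallel to \<open>i\<close>.
\<close>

lemma facet_cell_subset_gauss_preimage:
  fixes n :: "'a::euclidean_space \<Rightarrow> nat"
  assumes \<delta>: "0 < \<delta>" and n: "\<forall>j\<in>Basis. 0 < n j"
    and i: "i \<in> Basis" and k: "k \<in> facet_corners n (i, b)" and x: "x \<in> facet_cell \<delta> i k"
  shows "x \<in> gauss_domain (nat_box n)" "gauss_map (nat_box n) x = facet_normal (i, b)"
proof -
  have xi: "x \<bullet> i = (if b then real (n i) else 0)"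
    using x facet_corners_D(1)[OF k i] by (simp add: facet_cell_def)
  have xj: "\<delta> \<le> x \<bullet> j" "x \<bullet> j \<le> real (n j) - \<delta>" if "j \<in> Basis" "j \<noteq> i" for j
  proof -
    have "real (k j) + 1 \<le> real (n j)"
      using facet_corners_D(2)[OF k i that] by linarith
    moreover have "real (k j) + \<delta> \<le> x \<bullet> j" "x \<bullet> j \<le> real (k j) + 1 - \<delta>"
      using x that by (auto simp: facet_cell_def)
    ultimately show "\<delta> \<le> x \<bullet> j" "x \<bullet> j \<le> real (n j) - \<delta>"
      by linarith+
  qed
  have "x \<in> nat_box n"
    unfolding mem_nat_box
  proof
    fix j :: 'a assume "j \<in> Basis"
    then show "0 \<le> x \<bullet> j \<and> x \<bullet> j \<le> real (n j)"
      using xi xj[of j] \<delta> by (cases "j = i") auto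
  qed
  have normal: "outer_unit_normal (nat_box n) x (facet_normal (i, b))"
    using outer_unit_normal_facet[of i x b n] i xi by simp
  have unique: "v = facet_normal (i, b)" if v: "outer_unit_normal (nat_box n) x v" for v
  proof -
    have vle: "t * (v \<bullet> j) \<le> 0" if "j \<in> Basis" "0 \<le> x \<bullet> j + t" "x \<bullet> j + t \<le> real (n j)" for j t
    proof -
      have "x + t *\<^sub>R j \<in> nat_box n"
        using \<open>x \<in> nat_box n\<close> that by (auto simp: mem_nat_box inner_add_left inner_Basis)
      then have "v \<bullet> (x + t *\<^sub>R j - x) \<le> 0"
        using v unfolding outer_unit_normal_def by blast
      then show ?thesis
        by simp
    qed
    have zero: "v \<bullet> j = 0" if "j \<in> Basis" "j \<noteq> i" for j
    proof -
      have "\<delta> * (v \<bullet> j) \<le> 0" "0 \<le> \<delta> * (v \<bullet> j)"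
        using vle[OF that(1), of \<delta>] vle[OF that(1), of "- \<delta>"] xj[OF that] \<delta> by simp_all
      then have "\<delta> * (v \<bullet> j) = 0"
        by linarith
      then show ?thesis
        using \<delta> by simp
    qed
    have v_eq: "v = (v \<bullet> i) *\<^sub>R i"
    proof (rule euclidean_eqI)
      fix j :: 'a assume "j \<in> Basis"
      then show "v \<bullet> j = ((v \<bullet> i) *\<^sub>R i) \<bullet> j"
        using zero[of j] i by (cases "j = i") (simp_all add: inner_Basis)
    qed
    from arg_cong[OF this, of norm] have "norm v = \<bar>v \<bullet> i\<bar>"
      using i by simp
    then have "\<bar>v \<bullet> i\<bar> = 1"
      using v by (simp add: outer_unit_normal_def)
    moreover have "0 \<le> v \<bullet> i" if b
      using vle[OF i, of "-1"] xi bspec[OF n i] that by simp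
    moreover have "v \<bullet> i \<le> 0" if "\<not> b"
      using vle[OF i, of 1] xi bspec[OF n i] that by simp
    ultimately have "v \<bullet> i = (if b then 1 else - 1)"
      by (auto split: if_splits)
    then have "(v \<bullet> i) *\<^sub>R i = facet_normal (i, b)"
      by (simp add: facet_normal_def)
    with v_eq show ?thesis
      by (rule trans)
  qed
  have "x \<in> frontier (nat_box n)"
    unfolding frontier_nat_box using \<open>x \<in> nat_box n\<close> i xi by (cases b) auto
  moreover have "\<exists>!v. outer_unit_normal (nat_box n) x v"
    using normal unique by (rule ex1I)
  ultimately show dom: "x \<in> gauss_domain (nat_box n)"
    by (simp add: gauss_domain_def)
  show "gauss_map (nat_box n) x = facet_normal (i, b)"
    by (rule gauss_map_eq[OF dom normal])
qed

lemma ennreal_le_of_shrunk_le: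
  fixes x y :: ennreal
  assumes "\<And>\<delta>. 0 < \<delta> \<Longrightarrow> \<delta> < 1 / 2 \<Longrightarrow> ennreal ((1 - 2 * \<delta>) ^ m) * x \<le> y"
  shows "x \<le> y"
proof (cases "x = top")
  case True
  have "ennreal ((1 / 2) ^ m) * top \<le> y"
    using assms[of "1 / 4"] True by simp
  then show ?thesis
    by (simp add: ennreal_mult_top True)
next
  case False
  have "((\<lambda>\<delta>. (1 - 2 * \<delta>) ^ m) \<longlongrightarrow> (1 - 2 * 0) ^ m) (at_right (0::real))"
    by (intro tendsto_intros)
  then have "((\<lambda>\<delta>. ennreal ((1 - 2 * \<delta>) ^ m)) \<longlongrightarrow> ennreal 1) (at_right (0::real))"
    by (intro tendsto_ennrealI) simp
  then have "((\<lambda>\<delta>. ennreal ((1 - 2 * \<delta>) ^ m) * x) \<longlongrightarrow> 1 * x) (at_right (0::real))"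
    using False ennreal_tendsto_cmult[of x "\<lambda>\<delta>. ennreal ((1 - 2 * \<delta>) ^ m)" "ennreal 1"]
    by (simp add: top.not_eq_extremum mult.commute)
  moreover have "eventually (\<lambda>\<delta>. ennreal ((1 - 2 * \<delta>) ^ m) * x \<le> y) (at_right (0::real))"
    using assms unfolding eventually_at_right_field by (intro exI[of _ "1 / 2"]) auto
  ultimately have "1 * x \<le> y"
    by (rule tendsto_upperbound) (simp add: trivial_limit_at_right_real)
  then show ?thesis
    by simp
qed

text \<open>
  The measure of a unit cell stays a parameter that depends on its direction only. The closed unit
  cells cover the facets, which bounds the measure from above. The shrunk cells lie in the facets and
  are pairwise separated, so that their measures add up, and by the scaling law the loss tends to \<open>0\<close>
  with \<open>\<delta>\<close>.
\<close>

lemma surface_area_measure_nat_box: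
  fixes n :: "'a::euclidean_space \<Rightarrow> nat"
  assumes n: "\<forall>j\<in>Basis. 0 < n j"
  shows "surface_area_measure (nat_box n) \<omega>
    = (\<Sum>p | fst p \<in> Basis \<and> facet_normal p \<in> \<omega>. of_nat (\<Prod>j\<in>Basis - {fst p}. n j) *
        hausdorff_measure (DIM('a) - 1) (facet_cell 0 (fst p) (\<lambda>_. 0)))"
proof -
  define m where "m = DIM('a) - 1"
  define A where "A = gauss_map (nat_box n) -` \<omega> \<inter> gauss_domain (nat_box n)"
  define P where "P = {p :: 'a \<times> bool. fst p \<in> Basis \<and> facet_normal p \<in> \<omega>}"
  define I where "I = Sigma P (facet_corners n)"
  define c where "c = (\<lambda>i::'a. hausdorff_measure m (facet_cell 0 i (\<lambda>_. 0)))"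
  have "P \<subseteq> Basis \<times> UNIV"
    by (auto simp: P_def)
  then have finP: "finite P"
    by (rule finite_subset) auto
  then have finI: "finite I"
    by (simp add: I_def finite_facet_corners)
  have total: "(\<Sum>q\<in>I. hausdorff_measure m (facet_cell \<delta> (fst (fst q)) (snd q)))
      = ennreal ((1 - 2 * \<delta>) ^ m) * (\<Sum>p\<in>P. of_nat (\<Prod>j\<in>Basis - {fst p}. n j) * c (fst p))"
    if "\<delta> < 1 / 2" for \<delta>
  proof -
    have "(\<Sum>q\<in>I. hausdorff_measure m (facet_cell \<delta> (fst (fst q)) (snd q)))
        = (\<Sum>p\<in>P. \<Sum>k\<in>facet_corners n p. hausdorff_measure m (facet_cell \<delta> (fst p) k))"
      unfolding I_def using finP by (simp add: sum.Sigma finite_facet_corners split_def)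
    also have "\<dots> = (\<Sum>p\<in>P. \<Sum>k\<in>facet_corners n p. ennreal ((1 - 2 * \<delta>) ^ m) * c (fst p))"
      unfolding c_def
      using that by (intro sum.cong refl hausdorff_measure_facet_cell) (auto simp: P_def)
    also have "\<dots> = ennreal ((1 - 2 * \<delta>) ^ m) * (\<Sum>p\<in>P. of_nat (\<Prod>j\<in>Basis - {fst p}. n j) * c (fst p))"
      unfolding sum_distrib_left
      by (intro sum.cong refl) (simp add: P_def card_facet_corners mult.left_commute del: of_nat_prod)
    finally show ?thesis .
  qed
  have "A \<subseteq> (\<Union>q\<in>I. facet_cell 0 (fst (fst q)) (snd q))"
  proof
    fix x assume "x \<in> A"
    then have "x \<in> gauss_domain (nat_box n)" "gauss_map (nat_box n) x \<in> \<omega>"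
      by (auto simp: A_def)
    from gauss_preimage_subset_cells[OF n this] obtain i b k
      where "k \<in> facet_corners n (i, b)" "i \<in> Basis" "facet_normal (i, b) \<in> \<omega>" "x \<in> facet_cell 0 i k"
      by blast
    then show "x \<in> (\<Union>q\<in>I. facet_cell 0 (fst (fst q)) (snd q))"
      by (intro UN_I[of "((i, b), k)"]) (auto simp: I_def P_def)
  qed
  then have "hausdorff_measure m A \<le> (\<Sum>q\<in>I. hausdorff_measure m (facet_cell 0 (fst (fst q)) (snd q)))"
    by (rule order_trans[OF hausdorff_measure_mono hausdorff_measure_UN_le[OF finI]])
  then have upper: "hausdorff_measure m A \<le> (\<Sum>p\<in>P. of_nat (\<Prod>j\<in>Basis - {fst p}. n j) * c (fst p))"
    by (simp add: total del: of_nat_prod)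
  have lower: "(\<Sum>p\<in>P. of_nat (\<Prod>j\<in>Basis - {fst p}. n j) * c (fst p)) \<le> hausdorff_measure m A"
  proof (rule ennreal_le_of_shrunk_le)
    fix \<delta> :: real
    assume \<delta>: "0 < \<delta>" "\<delta> < 1 / 2"
    have "(\<Sum>q\<in>I. hausdorff_measure m (facet_cell \<delta> (fst (fst q)) (snd q)))
        \<le> hausdorff_measure m (\<Union>q\<in>I. facet_cell \<delta> (fst (fst q)) (snd q))"
    proof (rule hausdorff_measure_separated_UN[OF finI \<delta>(1)])
      fix q q' x y
      assume "q \<in> I" "q' \<in> I" "q \<noteq> q'" "x \<in> facet_cell \<delta> (fst (fst q)) (snd q)"
        "y \<in> facet_cell \<delta> (fst (fst q')) (snd q')"
      then show "\<delta> \<le> dist x y"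
        using facet_cells_separated[OF \<delta> n, where i = "fst (fst q)" and i' = "fst (fst q')"
            and k = "snd q" and b = "snd (fst q)" and k' = "snd q'" and b' = "snd (fst q')"
            and x = x and y = y]
        by (auto simp: I_def P_def)
    qed
    also have "\<dots> \<le> hausdorff_measure m A"
    proof (rule hausdorff_measure_mono, rule subsetI)
      fix x
      assume "x \<in> (\<Union>q\<in>I. facet_cell \<delta> (fst (fst q)) (snd q))"
      then obtain i b k where q: "((i, b), k) \<in> I" "x \<in> facet_cell \<delta> i k"
        by (auto simp: I_def)
      then have ik: "i \<in> Basis" "k \<in> facet_corners n (i, b)" "facet_normal (i, b) \<in> \<omega>"
        by (auto simp: I_def P_def)
      show "x \<in> A"
        using facet_cell_subset_gauss_preimage[OF \<delta>(1) n ik(1,2) q(2)] ik(3) by (simp add: A_def)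
    qed
    finally show "ennreal ((1 - 2 * \<delta>) ^ m) *
        (\<Sum>p\<in>P. of_nat (\<Prod>j\<in>Basis - {fst p}. n j) * c (fst p)) \<le> hausdorff_measure m A"
      using total[OF \<delta>(2)] by simp
  qed
  show ?thesis
    using antisym[OF upper lower]
    unfolding surface_area_measure_def A_def P_def c_def m_def .
qed

text \<open>
  The normals of a box do not depend on its side lengths, so for boxes Blaschke addition is addition of
  the facet areas, one direction at a time.
\<close>

lemma blaschke_sum_nat_box:
  fixes l m n :: "'a::euclidean_space \<Rightarrow> nat"
  assumes pos: "\<forall>j\<in>Basis. 0 < l j \<and> 0 < m j \<and> 0 < n j"
    and area: "\<And>i. i \<in> Basis \<Longrightarrow>
      (\<Prod>j\<in>Basis - {i}. n j) = (\<Prod>j\<in>Basis - {i}. l j) + (\<Prod>j\<in>Basis - {i}. m j)"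
  shows "blaschke_sum (nat_box l) (nat_box m) (nat_box n)"
proof -
  have pos': "\<forall>j\<in>Basis. 0 < l j" "\<forall>j\<in>Basis. 0 < m j" "\<forall>j\<in>Basis. 0 < n j"
    using pos by auto
  have "surface_area_measure (nat_box n) \<omega>
      = surface_area_measure (nat_box l) \<omega> + surface_area_measure (nat_box m) \<omega>" for \<omega>
    unfolding surface_area_measure_nat_box[OF pos'(1)] surface_area_measure_nat_box[OF pos'(2)]
      surface_area_measure_nat_box[OF pos'(3)] sum.distrib[symmetric]
  proof (rule sum.cong[OF refl])
    fix p :: "'a \<times> bool"
    assume "p \<in> {p. fst p \<in> Basis \<and> facet_normal p \<in> \<omega>}"
    then show "of_nat (\<Prod>j\<in>Basis - {fst p}. n j) *
          hausdorff_measure (DIM('a) - 1) (facet_cell 0 (fst p) (\<lambda>_. 0))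
        = of_nat (\<Prod>j\<in>Basis - {fst p}. l j) *
            hausdorff_measure (DIM('a) - 1) (facet_cell 0 (fst p) (\<lambda>_. 0)) +
          of_nat (\<Prod>j\<in>Basis - {fst p}. m j) *
            hausdorff_measure (DIM('a) - 1) (facet_cell 0 (fst p) (\<lambda>_. 0))"
      by (simp add: area distrib_right del: of_nat_prod)
  qed
  then show ?thesis
    using pos' by (simp add: blaschke_sum_def convex_body_nat_box)
qed

section \<open>First Dirichlet eigenvalue of boxes\<close>

lemma partial_eq:
  "(u has_derivative u') (at x) \<Longrightarrow> partial i u x = u' i"
  by (simp add: partial_def frechet_derivative_at[symmetric])

lemma differentiable_on_open_at:
  "u differentiable_on S \<Longrightarrow> open S \<Longrightarrow> x \<in> S \<Longrightarrow> u differentiable (at x)"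
  using differentiable_on_eq_differentiable_at by blast

lemma has_real_derivative_along_line:
  fixes u :: "'a::euclidean_space \<Rightarrow> real"
  assumes "u differentiable (at (x + s *\<^sub>R i))"
  shows "((\<lambda>t. u (x + t *\<^sub>R i)) has_real_derivative partial i u (x + s *\<^sub>R i)) (at s)"
proof -
  define D where "D = frechet_derivative u (at (x + s *\<^sub>R i))"
  have D: "(u has_derivative D) (at (x + s *\<^sub>R i))"
    using assms unfolding D_def by (simp add: frechet_derivative_works[symmetric])
  then have lin: "linear D"
    by (simp add: has_derivative_linear)
  have "((\<lambda>t. x + t *\<^sub>R i) has_derivative (\<lambda>h. h *\<^sub>R i)) (at s)"
    by (auto intro!: derivative_eq_intros)
  from has_derivative_compose[OF this D]
  have "((\<lambda>t. u (x + t *\<^sub>R i)) has_derivative (\<lambda>h. D (h *\<^sub>R i))) (at s)" .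
  moreover have "(\<lambda>h. D (h *\<^sub>R i)) = (*) (D i)"
    using linear_scale[OF lin] by (auto simp: mult.commute)
  ultimately show ?thesis
    by (simp add: has_field_derivative_def partial_def D_def)
qed

lemma second_derivative_nonneg_at_minimum:
  fixes f f' :: "real \<Rightarrow> real"
  assumes "0 < \<delta>"
    and f: "\<And>s. \<bar>s\<bar> < \<delta> \<Longrightarrow> (f has_real_derivative f' s) (at s)"
    and f': "(f' has_real_derivative D) (at 0)"
    and min: "\<And>s. \<bar>s\<bar> < \<delta> \<Longrightarrow> f 0 \<le> f s"
  shows "0 \<le> D"
proof (rule ccontr)
  assume "\<not> 0 \<le> D"
  have "f' 0 = 0"
    using DERIV_local_min[OF f[of 0] \<open>0 < \<delta>\<close>] min \<open>0 < \<delta>\<close> by auto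
  with DERIV_neg_dec_right[OF f'] \<open>\<not> 0 \<le> D\<close> obtain d
    where d: "0 < d" "\<And>h. 0 < h \<Longrightarrow> h < d \<Longrightarrow> f' h < 0"
    by auto
  define h where "h = min d \<delta> / 2"
  have h: "0 < h" "h < d" "h < \<delta>"
    using d(1) \<open>0 < \<delta>\<close> by (auto simp: h_def)
  have "\<exists>z>0. z < h \<and> f h - f 0 = (h - 0) * f' z"
    using h by (intro MVT2 f) auto
  then obtain z where z: "0 < z" "z < h" "f h - f 0 = h * f' z"
    by auto
  have "f' z < 0"
    using d(2) z h by auto
  then have "h * f' z < 0"
    using h by (simp add: mult_pos_neg)
  then show False
    using min[of h] h z(3) by auto
qed

text \<open>
  On every coordinate line through \<open>x\<close> the difference \<open>v - u\<close> has a minimum at \<open>x\<close>, so none of its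
  pure second derivatives is negative there.
\<close>

lemma laplacian_le_at_touching_point:
  fixes u v :: "'a::euclidean_space \<Rightarrow> real"
  assumes S: "open S" "x \<in> S" and C2: "C2_on S u" "C2_on S v"
    and le: "\<And>y. y \<in> S \<Longrightarrow> u y \<le> v y" and eq: "u x = v x"
  shows "laplacian u x \<le> laplacian v x"
  unfolding laplacian_def
proof (rule sum_mono)
  fix i :: 'a
  assume i: "i \<in> Basis"
  obtain \<delta> where \<delta>: "0 < \<delta>" "ball x \<delta> \<subseteq> S"
    using S open_contains_ball by blast
  have near: "x + s *\<^sub>R i \<in> S" if "\<bar>s\<bar> < \<delta>" for s
    using \<delta>(2) that i by (auto simp: subset_iff dist_norm)
  have diff: "u differentiable (at y)" "v differentiable (at y)"
      "partial i u differentiable (at y)" "partial i v differentiable (at y)" if "y \<in> S" for y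
    using C2 i that S(1) differentiable_on_open_at unfolding C2_on_def by blast+
  have "0 \<le> partial i (partial i v) (x + 0 *\<^sub>R i) - partial i (partial i u) (x + 0 *\<^sub>R i)"
  proof (rule second_derivative_nonneg_at_minimum[OF \<delta>(1)])
    show "((\<lambda>t. v (x + t *\<^sub>R i) - u (x + t *\<^sub>R i)) has_real_derivative
        partial i v (x + s *\<^sub>R i) - partial i u (x + s *\<^sub>R i)) (at s)" if "\<bar>s\<bar> < \<delta>" for s
      using diff near[OF that] by (intro DERIV_diff has_real_derivative_along_line) auto
    show "((\<lambda>s. partial i v (x + s *\<^sub>R i) - partial i u (x + s *\<^sub>R i)) has_real_derivative
        partial i (partial i v) (x + 0 *\<^sub>R i) - partial i (partial i u) (x + 0 *\<^sub>R i)) (at 0)"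
      using diff S(2) by (intro DERIV_diff has_real_derivative_along_line) auto
  qed (use le eq near in auto)
  then show "partial i (partial i u) x \<le> partial i (partial i v) x"
    by simp
qed

text \<open>
  The constant and the phases are parameters because this makes the family closed under partial
  derivatives: differentiating a sine factor multiplies by its frequency and advances its phase by
  \<open>pi / 2\<close>.
\<close>

definition sine_product ::
    "real \<Rightarrow> ('a::euclidean_space \<Rightarrow> real) \<Rightarrow> ('a \<Rightarrow> real) \<Rightarrow> 'a \<Rightarrow> real" where
  "sine_product c \<alpha> \<beta> x = c * (\<Prod>j\<in>Basis. sin (\<alpha> j * (x \<bullet> j) + \<beta> j))"

lemma has_derivative_sine_product:
  "(sine_product c \<alpha> \<beta> has_derivative
     (\<lambda>h. \<Sum>i\<in>Basis. (h \<bullet> i) * sine_product (c * \<alpha> i) \<alpha> (\<beta>(i := \<beta> i + pi / 2)) x)) (at x)"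
proof -
  have "((\<lambda>x. \<Prod>j\<in>Basis. sin (\<alpha> j * (x \<bullet> j) + \<beta> j)) has_derivative
      (\<lambda>h. \<Sum>i\<in>Basis. (\<alpha> i * (h \<bullet> i) * cos (\<alpha> i * (x \<bullet> i) + \<beta> i)) *
        (\<Prod>j\<in>Basis - {i}. sin (\<alpha> j * (x \<bullet> j) + \<beta> j)))) (at x)"
    by (rule has_derivative_prod) (auto intro!: derivative_eq_intros)
  then have "(sine_product c \<alpha> \<beta> has_derivative
      (\<lambda>h. c * (\<Sum>i\<in>Basis. (\<alpha> i * (h \<bullet> i) * cos (\<alpha> i * (x \<bullet> i) + \<beta> i)) *
        (\<Prod>j\<in>Basis - {i}. sin (\<alpha> j * (x \<bullet> j) + \<beta> j))))) (at x)"
    unfolding sine_product_def[abs_def] by (rule has_derivative_mult_right)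
  moreover have "sine_product (c * \<alpha> i) \<alpha> (\<beta>(i := \<beta> i + pi / 2)) x
      = c * \<alpha> i * (cos (\<alpha> i * (x \<bullet> i) + \<beta> i) *
        (\<Prod>j\<in>Basis - {i}. sin (\<alpha> j * (x \<bullet> j) + \<beta> j)))" if "i \<in> Basis" for i
  proof -
    have "sin (\<alpha> i * (x \<bullet> i) + (\<beta> i + pi / 2)) = cos (\<alpha> i * (x \<bullet> i) + \<beta> i)"
      using sin_add[of "\<alpha> i * (x \<bullet> i) + \<beta> i" "pi / 2"] by (simp add: add.assoc)
    then show ?thesis
      using that by (simp add: sine_product_def prod.remove[of Basis i])
  qed
  ultimately show ?thesis
    by (simp add: sum_distrib_left ac_simps cong: sum.cong)
qed

lemma partial_sine_product:
  assumes "i \<in> Basis"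
  shows "partial i (sine_product c \<alpha> \<beta>) = sine_product (c * \<alpha> i) \<alpha> (\<beta>(i := \<beta> i + pi / 2))"
proof
  fix x
  have "partial i (sine_product c \<alpha> \<beta>) x
      = (\<Sum>j\<in>Basis. (i \<bullet> j) * sine_product (c * \<alpha> j) \<alpha> (\<beta>(j := \<beta> j + pi / 2)) x)"
    by (rule partial_eq[OF has_derivative_sine_product])
  also have "\<dots> = (\<Sum>j\<in>{i}. (i \<bullet> j) * sine_product (c * \<alpha> j) \<alpha> (\<beta>(j := \<beta> j + pi / 2)) x)"
    using assms by (intro sum.mono_neutral_right) (auto simp: inner_Basis)
  finally show "partial i (sine_product c \<alpha> \<beta>) x
      = sine_product (c * \<alpha> i) \<alpha> (\<beta>(i := \<beta> i + pi / 2)) x"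
    using assms by simp
qed

lemma sine_product_differentiable: "sine_product c \<alpha> \<beta> differentiable (at x)"
  using has_derivative_sine_product differentiableI by blast

lemma continuous_on_sine_product: "continuous_on S (sine_product c \<alpha> \<beta>)"
  unfolding sine_product_def[abs_def] by (intro continuous_intros)

lemma C2_on_sine_product: "C2_on S (sine_product c \<alpha> \<beta>)"
  unfolding C2_on_def
  by (auto simp: partial_sine_product continuous_on_sine_product
      intro!: differentiable_at_imp_differentiable_on sine_product_differentiable)

lemma laplacian_sine_product:
  "laplacian (sine_product c \<alpha> \<beta>) x = - (\<Sum>i\<in>Basis. (\<alpha> i)\<^sup>2) * sine_product c \<alpha> \<beta> x"
proof -
  have "partial i (partial i (sine_product c \<alpha> \<beta>)) x = - ((\<alpha> i)\<^sup>2) * sine_product c \<alpha> \<beta> x"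
    if i: "i \<in> Basis" for i
  proof -
    have "sin (\<alpha> i * (x \<bullet> i) + (\<beta> i + pi / 2 + pi / 2)) = - sin (\<alpha> i * (x \<bullet> i) + \<beta> i)"
      using sin_periodic_pi[of "\<alpha> i * (x \<bullet> i) + \<beta> i"] by (simp add: add.assoc)
    then show ?thesis
      using i by (simp add: partial_sine_product sine_product_def prod.remove[of Basis i]
          power2_eq_square)
  qed
  then show ?thesis
    by (simp add: laplacian_def sum_distrib_right sum_negf)
qed

text \<open>
  This is Barta's principle: a function that is positive on all of \<open>K\<close> and satisfies
  \<open>- \<Delta> \<phi> = l \<phi>\<close> bounds every Dirichlet eigenvalue \<open>m\<close> from below by \<open>l\<close>. If \<open>u\<close> is an
  eigenfunction, then \<open>\<bar>u\<bar> / \<phi>\<close> is largest at some interior point \<open>x\<close>, and a multiple \<open>w\<close> of \<open>\<phi>\<close>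
  touches \<open>u\<close> there, from above if \<open>u x > 0\<close> and from below if \<open>u x < 0\<close>. Comparing
  \<open>\<Delta> u x = - m * u x\<close> with \<open>\<Delta> w x = - l * u x\<close> gives \<open>l \<le> m\<close> in both cases.
\<close>

lemma dirichlet_eigenvalue_ge:
  fixes K :: "'a::euclidean_space set"
  assumes "compact K" and m: "dirichlet_eigenvalue K m"
    and pos: "\<And>x. x \<in> K \<Longrightarrow> 0 < sine_product 1 \<alpha> \<beta> x"
  shows "(\<Sum>i\<in>Basis. (\<alpha> i)\<^sup>2) \<le> m"
proof -
  define \<phi> where "\<phi> = sine_product 1 \<alpha> \<beta>"
  define l where "l = (\<Sum>i\<in>Basis. (\<alpha> i)\<^sup>2)"
  obtain u z where u: "continuous_on K u" "C2_on (interior K) u"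
      "\<And>x. x \<in> interior K \<Longrightarrow> - laplacian u x = m * u x" "\<And>x. x \<in> frontier K \<Longrightarrow> u x = 0"
    and z: "z \<in> interior K" "u z \<noteq> 0"
    using m unfolding dirichlet_eigenvalue_def by blast
  have pos': "0 < \<phi> x" if "x \<in> K" for x
    using pos that by (simp add: \<phi>_def)
  have "continuous_on K (\<lambda>x. \<bar>u x\<bar> / \<phi> x)"
    using u(1) pos' continuous_on_sine_product[of K 1 \<alpha> \<beta>]
    by (intro continuous_intros) (force simp: \<phi>_def)+
  moreover have "K \<noteq> {}"
    using z interior_subset by blast
  ultimately obtain x where x: "x \<in> K" "\<And>y. y \<in> K \<Longrightarrow> \<bar>u y\<bar> / \<phi> y \<le> \<bar>u x\<bar> / \<phi> x"
    using continuous_attains_sup[OF \<open>compact K\<close>] by blast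
  have "z \<in> K"
    using z interior_subset by blast
  then have "0 < \<bar>u z\<bar> / \<phi> z"
    using z pos' by simp
  then have "u x \<noteq> 0"
    using x(2)[OF \<open>z \<in> K\<close>] by auto
  then have int: "x \<in> interior K"
    using u(4) x(1) closure_subset by (auto simp: frontier_def)
  define t where "t = u x / \<phi> x"
  define w where "w = sine_product t \<alpha> \<beta>"
  have w: "w y = t * \<phi> y" for y
    by (simp add: w_def \<phi>_def sine_product_def)
  have "u x = w x"
    using pos'[OF x(1)] by (simp add: w t_def)
  have bound: "\<bar>u y\<bar> \<le> \<bar>t\<bar> * \<phi> y" if "y \<in> interior K" for y
  proof -
    have "y \<in> K" using that interior_subset by blast
    then show ?thesis
      using x(2)[of y] pos'[of y] pos'[OF x(1)] by (simp add: t_def abs_divide field_simps)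
  qed
  have lap_w: "laplacian w x = - l * u x"
    unfolding \<open>u x = w x\<close> unfolding w_def l_def by (rule laplacian_sine_product)
  have C2w: "C2_on (interior K) w"
    unfolding w_def by (rule C2_on_sine_product)
  have lap_u: "laplacian u x = - m * u x"
    using u(3)[OF int] by simp
  show ?thesis
  proof (cases "0 < u x")
    case True
    then have "0 < t" using pos'[OF x(1)] by (simp add: t_def)
    have "laplacian u x \<le> laplacian w x"
      using bound \<open>0 < t\<close> \<open>u x = w x\<close>
      by (intro laplacian_le_at_touching_point[OF open_interior int u(2) C2w]) (fastforce simp: w)+
    then show ?thesis
      using True by (simp add: lap_w lap_u l_def)
  next
    case False
    then have "u x < 0" using \<open>u x \<noteq> 0\<close> by simp
    then have "t < 0" using pos'[OF x(1)] by (simp add: t_def divide_neg_pos)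
    have "laplacian w x \<le> laplacian u x"
      using bound \<open>t < 0\<close> \<open>u x = w x\<close>
      by (intro laplacian_le_at_touching_point[OF open_interior int C2w u(2)]) (fastforce simp: w)+
    then show ?thesis
      using \<open>u x < 0\<close> by (simp add: lap_w lap_u l_def)
  qed
qed

lemma dirichlet_eigenvalue_box:
  fixes a :: "'a::euclidean_space"
  assumes a: "\<And>i. i \<in> Basis \<Longrightarrow> 0 < a \<bullet> i"
  shows "dirichlet_eigenvalue (cbox 0 a) (\<Sum>i\<in>Basis. (pi / (a \<bullet> i))\<^sup>2)"
  unfolding dirichlet_eigenvalue_def
proof (intro exI conjI ballI)
  define u where "u = sine_product 1 (\<lambda>i. pi / (a \<bullet> i)) (\<lambda>i::'a. 0)"
  show "continuous_on (cbox 0 a) u"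
    unfolding u_def by (rule continuous_on_sine_product)
  show "C2_on (interior (cbox 0 a)) u"
    unfolding u_def by (rule C2_on_sine_product)
  show "- laplacian u x = (\<Sum>i\<in>Basis. (pi / (a \<bullet> i))\<^sup>2) * u x" for x
    unfolding u_def laplacian_sine_product by simp
  have "(1 / 2) *\<^sub>R a \<in> box 0 a"
    using a by (simp add: mem_box)
  moreover have "u ((1 / 2) *\<^sub>R a) = 1"
    using a by (auto simp: u_def sine_product_def intro!: prod.neutral)
      (metis less_irrefl nonzero_mult_div_cancel_left sin_pi_half)
  ultimately show "\<exists>x\<in>interior (cbox 0 a). u x \<noteq> 0"
    by (auto intro!: bexI[of _ "(1 / 2) *\<^sub>R a"])
  fix x
  assume "x \<in> frontier (cbox 0 a)"
  then obtain i where i: "i \<in> Basis" "x \<bullet> i = 0 \<or> x \<bullet> i = a \<bullet> i"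
    by (auto simp: frontier_cbox mem_box order_le_less)
  then have "sin (pi / (a \<bullet> i) * (x \<bullet> i) + 0) = 0"
    using a[of i] by auto
  then show "u x = 0"
    using i(1) by (auto simp: u_def sine_product_def prod_zero_iff)
qed

text \<open>
  The first eigenfunction of the box itself vanishes on the boundary and cannot serve as the positive
  comparison function. The first eigenfunctions of the boxes enlarged by \<open>\<epsilon>\<close> on every side are
  positive on the closed box, and their eigenvalues tend to that of the box.
\<close>

lemma dirichlet_eigenvalue_box_ge:
  fixes a :: "'a::euclidean_space"
  assumes a: "\<And>i. i \<in> Basis \<Longrightarrow> 0 < a \<bullet> i" and m: "dirichlet_eigenvalue (cbox 0 a) m"
  shows "(\<Sum>i\<in>Basis. (pi / (a \<bullet> i))\<^sup>2) \<le> m"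
proof -
  have "(\<Sum>i\<in>Basis. (pi / (a \<bullet> i + 2 * \<epsilon>))\<^sup>2) \<le> m" if "0 < \<epsilon>" for \<epsilon>
  proof (rule dirichlet_eigenvalue_ge[OF compact_cbox m])
    fix x
    assume x: "x \<in> cbox 0 a"
    show "0 < sine_product 1 (\<lambda>i. pi / (a \<bullet> i + 2 * \<epsilon>)) (\<lambda>i. pi / (a \<bullet> i + 2 * \<epsilon>) * \<epsilon>) x"
      unfolding sine_product_def mult_1
    proof (rule prod_pos)
      fix i :: 'a
      assume i: "i \<in> Basis"
      have "0 \<le> x \<bullet> i" "x \<bullet> i \<le> a \<bullet> i"
        using x i by (auto simp: mem_box)
      moreover have "0 < a \<bullet> i + 2 * \<epsilon>"
        using a[OF i] that by simp
      ultimately show "0 < sin (pi / (a \<bullet> i + 2 * \<epsilon>) * (x \<bullet> i) + pi / (a \<bullet> i + 2 * \<epsilon>) * \<epsilon>)"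
        using that
        by (intro sin_gt_zero) (auto simp: divide_simps distrib_left[symmetric] simp del: distrib_left)
    qed
  qed
  then have "eventually (\<lambda>\<epsilon>. (\<Sum>i\<in>Basis. (pi / (a \<bullet> i + 2 * \<epsilon>))\<^sup>2) \<le> m) (at_right 0)"
    by (auto simp: eventually_at_right_field intro: exI[of _ 1])
  moreover have "((\<lambda>\<epsilon>. \<Sum>i\<in>Basis. (pi / (a \<bullet> i + 2 * \<epsilon>))\<^sup>2) \<longlongrightarrow>
      (\<Sum>i\<in>Basis. (pi / (a \<bullet> i + 2 * 0))\<^sup>2)) (at_right 0)"
    using a by (intro tendsto_intros) (auto dest: a)
  ultimately have "(\<Sum>i\<in>Basis. (pi / (a \<bullet> i + 2 * 0))\<^sup>2) \<le> m"
    by (intro tendsto_upperbound) (auto simp: trivial_limit_at_right_real)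
  then show ?thesis
    by simp
qed

lemma lambda1_eq:
  assumes "dirichlet_eigenvalue K l" "\<And>m. dirichlet_eigenvalue K m \<Longrightarrow> l \<le> m"
  shows "lambda1 K = l"
  using assms Least_equality[of "dirichlet_eigenvalue K" l] unfolding lambda1_def by auto

lemma lambda1_box:
  fixes a :: "'a::euclidean_space"
  assumes "\<And>i. i \<in> Basis \<Longrightarrow> 0 < a \<bullet> i"
  shows "lambda1 (cbox 0 a) = (\<Sum>i\<in>Basis. (pi / (a \<bullet> i))\<^sup>2)"
proof (rule lambda1_eq)
  show "dirichlet_eigenvalue (cbox 0 a) (\<Sum>i\<in>Basis. (pi / (a \<bullet> i))\<^sup>2)"
    using assms by (rule dirichlet_eigenvalue_box)
  show "(\<Sum>i\<in>Basis. (pi / (a \<bullet> i))\<^sup>2) \<le> m" if "dirichlet_eigenvalue (cbox 0 a) m" for m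
    using assms that by (rule dirichlet_eigenvalue_box_ge)
qed

section \<open>Homogeneity of the first eigenvalue\<close>

lemma partial_cong_open:
  assumes "open S" "x \<in> S" "\<And>y. y \<in> S \<Longrightarrow> f y = g y"
  shows "partial i f x = partial i g x"
    and "f differentiable (at x) \<longleftrightarrow> g differentiable (at x)"
proof -
  have "(f has_derivative D) (at x) \<longleftrightarrow> (g has_derivative D) (at x)" for D
    using assms by (metis has_derivative_transform_within_open)
  then show "partial i f x = partial i g x" "f differentiable (at x) \<longleftrightarrow> g differentiable (at x)"
    by (simp_all add: partial_def frechet_derivative_def differentiable_def)
qed

lemma differentiable_partial_scaled:
  fixes w :: "'a::euclidean_space \<Rightarrow> real"
  assumes "w differentiable (at (s *\<^sub>R x))"
  shows "(\<lambda>y. c * w (s *\<^sub>R y)) differentiable (at x)"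
    and "partial i (\<lambda>y. c * w (s *\<^sub>R y)) x = c * s * partial i w (s *\<^sub>R x)"
proof -
  define D where "D = frechet_derivative w (at (s *\<^sub>R x))"
  have D: "(w has_derivative D) (at (s *\<^sub>R x))"
    using assms unfolding D_def by (simp add: frechet_derivative_works[symmetric])
  have "((\<lambda>y. s *\<^sub>R y) has_derivative (\<lambda>h. s *\<^sub>R h)) (at x)"
    by (auto intro!: derivative_eq_intros)
  from has_derivative_mult_right[OF has_derivative_compose[OF this D]]
  have *: "((\<lambda>y. c * w (s *\<^sub>R y)) has_derivative (\<lambda>h. c * D (s *\<^sub>R h))) (at x)" .
  then show "(\<lambda>y. c * w (s *\<^sub>R y)) differentiable (at x)"
    by (rule differentiableI)
  show "partial i (\<lambda>y. c * w (s *\<^sub>R y)) x = c * s * partial i w (s *\<^sub>R x)"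
    using linear_scale[OF has_derivative_linear[OF D]]
    unfolding partial_eq[OF *] by (simp add: partial_def D_def)
qed

lemma C2_on_scaled:
  fixes u :: "'a::euclidean_space \<Rightarrow> real"
  assumes S: "open S" and C2: "C2_on S u" and T: "open T" "\<And>x. x \<in> T \<Longrightarrow> s *\<^sub>R x \<in> S"
  shows "C2_on T (\<lambda>x. u (s *\<^sub>R x))"
    and "x \<in> T \<Longrightarrow> laplacian (\<lambda>x. u (s *\<^sub>R x)) x = s\<^sup>2 * laplacian u (s *\<^sub>R x)"
proof -
  have diff: "u differentiable (at (s *\<^sub>R x))" "partial i u differentiable (at (s *\<^sub>R x))"
    if "x \<in> T" "i \<in> Basis" for x i
    using C2 that S T(2)[OF that(1)] differentiable_on_open_at unfolding C2_on_def by blast+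
  have first: "partial i (\<lambda>x. u (s *\<^sub>R x)) x = s * partial i u (s *\<^sub>R x)"
    if "x \<in> T" "i \<in> Basis" for x i
    using differentiable_partial_scaled(2)[OF diff(1)[OF that], where i = i and c = 1] by simp
  \<comment> \<open>The scaling rule for first derivatives holds on the open set \<open>T\<close> and can hence be
    differentiated once more.\<close>
  have second: "partial j (partial i (\<lambda>x. u (s *\<^sub>R x))) x = s\<^sup>2 * partial j (partial i u) (s *\<^sub>R x)"
      "partial i (\<lambda>x. u (s *\<^sub>R x)) differentiable (at x)"
    if "x \<in> T" "i \<in> Basis" for x i j
    using differentiable_partial_scaled[OF diff(2)[OF that], where c = s]
      partial_cong_open[OF T(1) that(1) first[OF _ that(2)]]
    by (simp_all add: power2_eq_square)
  show "laplacian (\<lambda>x. u (s *\<^sub>R x)) x = s\<^sup>2 * laplacian u (s *\<^sub>R x)" if "x \<in> T"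
    unfolding laplacian_def using that by (simp add: second sum_distrib_left)
  show "C2_on T (\<lambda>x. u (s *\<^sub>R x))"
    unfolding C2_on_def
  proof (intro conjI ballI)
    obtain i0 :: 'a where "i0 \<in> Basis" using nonempty_Basis by blast
    then show "(\<lambda>x. u (s *\<^sub>R x)) differentiable_on T"
      using differentiable_partial_scaled(1)[OF diff(1), where c = 1]
      by (auto intro!: differentiable_at_imp_differentiable_on)
    show "partial i (\<lambda>x. u (s *\<^sub>R x)) differentiable_on T" if "i \<in> Basis" for i
      using second(2) that by (intro differentiable_at_imp_differentiable_on) auto
    fix i j :: 'a
    assume ij: "i \<in> Basis" "j \<in> Basis"
    have "continuous_on S (partial j (partial i u))"
      using C2 ij by (simp add: C2_on_def)
    then have "continuous_on T (\<lambda>x. partial j (partial i u) (s *\<^sub>R x))"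
      by (rule continuous_on_compose2) (auto intro!: continuous_intros T(2))
    then have "continuous_on T (\<lambda>x. s\<^sup>2 * partial j (partial i u) (s *\<^sub>R x))"
      by (intro continuous_intros)
    then show "continuous_on T (partial j (partial i (\<lambda>x. u (s *\<^sub>R x))))"
      using second(1)[OF _ ij(1)] by (simp cong: continuous_on_cong_simp)
  qed
qed

lemma dirichlet_eigenvalue_scaled:
  fixes K :: "'a::euclidean_space set"
  assumes "0 < t" and "dirichlet_eigenvalue K l"
  shows "dirichlet_eigenvalue ((\<lambda>x. t *\<^sub>R x) ` K) (l / t\<^sup>2)"
proof -
  obtain u z where u: "continuous_on K u" "C2_on (interior K) u"
      "\<And>x. x \<in> interior K \<Longrightarrow> - laplacian u x = l * u x" "\<And>x. x \<in> frontier K \<Longrightarrow> u x = 0"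
    and z: "z \<in> interior K" "u z \<noteq> 0"
    using assms(2) unfolding dirichlet_eigenvalue_def by blast
  have lin: "linear (\<lambda>x::'a. t *\<^sub>R x)" "inj (\<lambda>x::'a. t *\<^sub>R x)"
    using \<open>0 < t\<close> by (auto simp: injective_scaleR)
  have int: "interior ((\<lambda>x. t *\<^sub>R x) ` K) = (\<lambda>x. t *\<^sub>R x) ` interior K"
    by (rule interior_injective_linear_image[OF lin])
  have fr: "frontier ((\<lambda>x. t *\<^sub>R x) ` K) = (\<lambda>x. t *\<^sub>R x) ` frontier K"
    using closure_injective_linear_image[OF lin, of K] image_set_diff[OF lin(2)]
    by (simp add: frontier_def int)
  define v where "v = (\<lambda>x. u ((1 / t) *\<^sub>R x))"
  have inv: "(1 / t) *\<^sub>R x \<in> interior K" if "x \<in> interior ((\<lambda>x. t *\<^sub>R x) ` K)" for x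
    using that \<open>0 < t\<close> by (auto simp: int)
  have v: "C2_on (interior ((\<lambda>x. t *\<^sub>R x) ` K)) v"
      "\<And>x. x \<in> interior ((\<lambda>x. t *\<^sub>R x) ` K) \<Longrightarrow>
        laplacian v x = (1 / t)\<^sup>2 * laplacian u ((1 / t) *\<^sub>R x)"
    unfolding v_def using C2_on_scaled[OF open_interior u(2) open_interior] inv by blast+
  show ?thesis
    unfolding dirichlet_eigenvalue_def
  proof (intro exI conjI ballI)
    show "continuous_on ((\<lambda>x. t *\<^sub>R x) ` K) v"
      unfolding v_def using \<open>0 < t\<close>
      by (intro continuous_on_compose2[OF u(1)] continuous_intros) auto
    show "C2_on (interior ((\<lambda>x. t *\<^sub>R x) ` K)) v"
      by (rule v(1))
    show "\<exists>x\<in>interior ((\<lambda>x. t *\<^sub>R x) ` K). v x \<noteq> 0"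
      using z \<open>0 < t\<close> by (intro bexI[of _ "t *\<^sub>R z"]) (auto simp: v_def int)
    show "- laplacian v x = l / t\<^sup>2 * v x" if "x \<in> interior ((\<lambda>x. t *\<^sub>R x) ` K)" for x
    proof -
      have "laplacian u ((1 / t) *\<^sub>R x) = - (l * v x)"
        using u(3)[OF inv[OF that]] unfolding v_def by linarith
      then show ?thesis
        unfolding v(2)[OF that] by (simp add: power_divide)
    qed
    show "v x = 0" if "x \<in> frontier ((\<lambda>x. t *\<^sub>R x) ` K)" for x
      using that u(4) \<open>0 < t\<close> by (auto simp: v_def fr)
  qed
qed

lemma dirichlet_eigenvalue_scaled_iff:
  fixes K :: "'a::euclidean_space set"
  assumes "0 < t"
  shows "dirichlet_eigenvalue ((\<lambda>x. t *\<^sub>R x) ` K) l \<longleftrightarrow> dirichlet_eigenvalue K (t\<^sup>2 * l)"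
proof
  assume "dirichlet_eigenvalue ((\<lambda>x. t *\<^sub>R x) ` K) l"
  from dirichlet_eigenvalue_scaled[OF _ this, of "1 / t"]
  show "dirichlet_eigenvalue K (t\<^sup>2 * l)"
    using assms by (simp add: image_image power_divide mult.commute)
next
  assume "dirichlet_eigenvalue K (t\<^sup>2 * l)"
  from dirichlet_eigenvalue_scaled[OF assms this]
  show "dirichlet_eigenvalue ((\<lambda>x. t *\<^sub>R x) ` K) l"
    using assms by simp
qed

lemma lambda1_scaled:
  fixes K :: "'a::euclidean_space set"
  assumes "0 < t"
  shows "lambda1 ((\<lambda>x. t *\<^sub>R x) ` K) = lambda1 K / t\<^sup>2"
proof (cases "\<exists>l. dirichlet_eigenvalue K l \<and> (\<forall>m. dirichlet_eigenvalue K m \<longrightarrow> l \<le> m)")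
  case True
  then obtain l where l: "dirichlet_eigenvalue K l" "\<And>m. dirichlet_eigenvalue K m \<Longrightarrow> l \<le> m"
    by blast
  have "lambda1 ((\<lambda>x. t *\<^sub>R x) ` K) = l / t\<^sup>2"
    using assms l(1) l(2)[of "t\<^sup>2 * _"]
    by (intro lambda1_eq) (auto simp: dirichlet_eigenvalue_scaled_iff field_simps)
  then show ?thesis
    using lambda1_eq[OF l] by simp
next
  case False
  have "\<not> (\<exists>l. dirichlet_eigenvalue ((\<lambda>x. t *\<^sub>R x) ` K) l \<and>
      (\<forall>m. dirichlet_eigenvalue ((\<lambda>x. t *\<^sub>R x) ` K) m \<longrightarrow> l \<le> m))"
  proof
    assume "\<exists>l. dirichlet_eigenvalue ((\<lambda>x. t *\<^sub>R x) ` K) l \<and>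
      (\<forall>m. dirichlet_eigenvalue ((\<lambda>x. t *\<^sub>R x) ` K) m \<longrightarrow> l \<le> m)"
    then obtain l where l: "dirichlet_eigenvalue K (t\<^sup>2 * l)"
        "\<And>m. dirichlet_eigenvalue K (t\<^sup>2 * m) \<Longrightarrow> l \<le> m"
      by (auto simp: dirichlet_eigenvalue_scaled_iff[OF assms])
    have "t\<^sup>2 * l \<le> m" if "dirichlet_eigenvalue K m" for m
      using l(2)[of "m / t\<^sup>2"] that assms by (simp add: field_simps)
    with l(1) False show False by blast
  qed
  then show ?thesis
    unfolding lambda1_def if_not_P[OF False] by (subst if_not_P) auto
qed

lemma homogeneous_lambda1: "homogeneous_functional (-2) lambda1"
  by (auto simp: homogeneous_functional_def lambda1_scaled powr_minus powr_numeral divide_inverse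
      mult.commute)

section \<open>Blaschke sums of bricks in three dimensions\<close>

definition brick :: "nat \<Rightarrow> nat \<Rightarrow> (real^3) \<Rightarrow> nat" where
  "brick h w j = (if j = axis 1 1 then h else w)"

lemma card_Basis_minus_axis: "card ((Basis :: (real^3) set) - {axis 1 1}) = 2"
  by (simp add: card_Diff_singleton axis_in_Basis_iff)

lemma blaschke_sum_brick:
  assumes pos: "0 < h1" "0 < w1" "0 < h2" "0 < w2" "0 < h" "0 < w"
    and area: "w\<^sup>2 = w1\<^sup>2 + w2\<^sup>2" "h * w = h1 * w1 + h2 * w2"
  shows "blaschke_sum (nat_box (brick h1 w1)) (nat_box (brick h2 w2)) (nat_box (brick h w))"
proof (rule blaschke_sum_nat_box)
  show "\<forall>j\<in>Basis. 0 < brick h1 w1 j \<and> 0 < brick h2 w2 j \<and> 0 < brick h w j"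
    using pos by (simp add: brick_def)
  fix i :: "real^3"
  assume i: "i \<in> Basis"
  have e: "axis 1 1 \<in> (Basis :: (real^3) set)"
    by (simp add: axis_in_Basis_iff)
  have prod: "(\<Prod>j\<in>Basis - {i}. brick h w j) = (if i = axis 1 1 then w\<^sup>2 else h * w)" for h w
  proof (cases "i = axis 1 1")
    case True
    have "(\<Prod>j\<in>Basis - {i}. brick h w j) = (\<Prod>j\<in>(Basis :: (real^3) set) - {axis 1 1}. w)"
      using True by (intro prod.cong) (auto simp: brick_def)
    then show ?thesis
      using True by (simp only: prod_constant card_Basis_minus_axis simp_thms if_True)
  next
    case False
    have "card ((Basis :: (real^3) set) - {i} - {axis 1 1}) = 1"
      using i e False by (simp add: card_Diff_singleton)
    moreover have "(\<Prod>j\<in>Basis - {i} - {axis 1 1}. brick h w j) = (\<Prod>j\<in>Basis - {i} - {axis 1 1 :: real^3}. w)"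
      by (intro prod.cong) (auto simp: brick_def)
    moreover have "(\<Prod>j\<in>Basis - {i}. brick h w j)
        = brick h w (axis 1 1) * (\<Prod>j\<in>Basis - {i} - {axis 1 1}. brick h w j)"
      using e False by (intro prod.remove) auto
    ultimately show ?thesis
      using False by (simp add: brick_def)
  qed
  show "(\<Prod>j\<in>Basis - {i}. brick h w j)
      = (\<Prod>j\<in>Basis - {i}. brick h1 w1 j) + (\<Prod>j\<in>Basis - {i}. brick h2 w2 j)"
    unfolding prod using area by simp
qed

lemma lambda1_brick:
  assumes "0 < h" "0 < w"
  shows "lambda1 (nat_box (brick h w)) = pi\<^sup>2 * (1 / (real h)\<^sup>2 + 2 / (real w)\<^sup>2)"
proof -
  define a where "a = (\<Sum>j\<in>Basis. real (brick h w j) *\<^sub>R j)"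
  have a: "a \<bullet> i = real (brick h w i)" if "i \<in> Basis" for i
    using that unfolding a_def by (rule sum_Basis_inner)
  have "lambda1 (nat_box (brick h w)) = (\<Sum>i\<in>Basis. (pi / (a \<bullet> i))\<^sup>2)"
    unfolding nat_box_def a_def[symmetric]
    using assms by (intro lambda1_box) (simp add: a brick_def)
  also have "\<dots> = (\<Sum>i\<in>Basis. (pi / real (brick h w i))\<^sup>2)"
    by (intro sum.cong) (auto simp: a)
  also have "\<dots> = (pi / real h)\<^sup>2 + (\<Sum>i\<in>(Basis :: (real^3) set) - {axis 1 1}. (pi / real (brick h w i))\<^sup>2)"
    by (subst sum.remove[of _ "axis 1 1"]) (auto simp: axis_in_Basis_iff brick_def)
  also have "(\<Sum>i\<in>(Basis :: (real^3) set) - {axis 1 1}. (pi / real (brick h w i))\<^sup>2)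
      = (\<Sum>i\<in>(Basis :: (real^3) set) - {axis 1 1}. (pi / real w)\<^sup>2)"
    by (intro sum.cong) (auto simp: brick_def)
  also have "\<dots> = 2 * (pi / real w)\<^sup>2"
    by (simp only: sum_constant card_Basis_minus_axis of_nat_numeral)
  finally show ?thesis
    by (simp add: power_divide algebra_simps)
qed

theorem proposition2p7:
  shows "homogeneous_functional (-2) (lambda1 :: (real^3) set \<Rightarrow> real) \<and>
         \<not> kneser_suss (-2) (lambda1 :: (real^3) set \<Rightarrow> real) \<and>
         \<not> (\<forall>K L M :: (real^3) set.
              convex_body K \<and> convex_body L \<and> blaschke_sum K L M \<longrightarrow>
              inverse (lambda1 M) \<ge> inverse (lambda1 K) + inverse (lambda1 L))"
proof -
  \<comment> \<open>The facet areas are \<open>81, 9\<close> and \<open>144, 36\<close> and \<open>225, 45\<close>. The widths are a Pythagorean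
    triple so that all side lengths are integers.\<close>
  define K where "K = nat_box (brick 1 9)"
  define L where "L = nat_box (brick 3 12)"
  define M where "M = nat_box (brick 3 15)"
  have bodies: "convex_body K" "convex_body L"
    unfolding K_def L_def by (rule convex_body_nat_box; simp add: brick_def)+
  have sum: "blaschke_sum K L M"
    unfolding K_def L_def M_def by (rule blaschke_sum_brick) auto
  have lambda: "lambda1 K = pi\<^sup>2 * (83 / 81)" "lambda1 L = pi\<^sup>2 * (1 / 8)" "lambda1 M = pi\<^sup>2 * (3 / 25)"
    unfolding K_def L_def M_def by (simp_all add: lambda1_brick)
  have less: "inverse (lambda1 M) < inverse (lambda1 K) + inverse (lambda1 L)"
  proof -
    have "inverse (pi\<^sup>2) * (25 / 3) < inverse (pi\<^sup>2) * (81 / 83 + 8 / 1)"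
      by (intro mult_strict_left_mono) auto
    then show ?thesis
      by (simp only: lambda inverse_mult_distrib inverse_divide distrib_left)
  qed
  have pos: "0 < lambda1 K" "0 < lambda1 L" "0 < lambda1 M"
    by (simp_all add: lambda)
  have "\<not> kneser_suss (-2) (lambda1 :: (real^3) set \<Rightarrow> real)"
  proof
    assume "kneser_suss (-2) (lambda1 :: (real^3) set \<Rightarrow> real)"
    then have "lambda1 K powr ((real DIM(real^3) - 1) / - 2) + lambda1 L powr ((real DIM(real^3) - 1) / - 2)
        \<le> lambda1 M powr ((real DIM(real^3) - 1) / - 2)"
      using bodies sum unfolding kneser_suss_def by blast
    moreover have "(real DIM(real^3) - 1) / - 2 = - 1"
      by simp
    ultimately have "lambda1 K powr - 1 + lambda1 L powr - 1 \<le> lambda1 M powr - 1"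
      by (simp only:)
    then show False
      using less pos by (simp add: powr_minus)
  qed
  moreover have "\<not> (\<forall>K L M :: (real^3) set.
      convex_body K \<and> convex_body L \<and> blaschke_sum K L M \<longrightarrow>
      inverse (lambda1 M) \<ge> inverse (lambda1 K) + inverse (lambda1 L))"
    using bodies sum less by (meson not_less)
  ultimately show ?thesis
    using homogeneous_lambda1 by blast
qed

end
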